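(* Let $m,n,b,c\in\mathbb Z_{\ge0}$ with $m\ge c$, $n-b+c\ge0$, and suppose $\alpha:=m-n+b-2c+\varsigma_2$ is positive and even. Put $\beta_c:=\lfloor c/2\rfloor$ and $\gamma_c:=\alpha/2$. Write the icanonical basis element $\mathfrak{B}^{(0,b,c)}_{2}$ of $L(m,n)$ in terms of Lusztig's canonical basis as $$\mathfrak{B}^{(0,b,c)}_{2}=F^{(b)}_{2}F^{(c)}_{1}\eta+\sum_{0<\theta\le c}\Omega_{m,n,\theta}^{(b,c)}F^{(b-\theta)}_{2}F^{(c-\theta)}_{1}\eta .$$ Then the coefficients $\Omega^{(b,c)}_{m,n,\theta}$, $0\le\theta\le c$, are given by $$\Omega^{(b,c)}_{m,n,\theta}=\Omega^{b,\theta}_{m-(c-\theta),\,n+(c-\theta)}$$ (where $\Omega^{b,c}_{m,n}:=\Omega^{(b,c)}_{m,n,c}$ denotes the coefficient for $\theta=c$) and $$\Omega^{b,c}_{m,n}=\sum_{x=0}^{\beta_c}\begin{bmatrix}\gamma_c+x-1\\ x\end{bmatrix}_{q^2}\begin{bmatrix}n-b+2c-2x\\ c-2x\end{bmatrix}q^{\frac{(c-2x)(c-1-2m)}{2}}\,q^{x(-m+n-b+c+1)}.$$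
   Context: For $t\ge1$, $r\in\mathbb Z$: $[r]_{q^t}=\frac{q^{tr}-q^{-tr}}{q^t-q^{-t}}$, $[r]_{q^t}!=[1]_{q^t}\cdots[r]_{q^t}$, $[0]_{q^t}!=1$, $\begin{bmatrix}r\\ s\end{bmatrix}_{q^t}=\frac{[r]_{q^t}[r-1]_{q^t}\cdots[r-s+1]_{q^t}}{[s]_{q^t}!}$ for $s\ge0$; the subscript is omitted when $t=1$. $X^{(r)}=X^r/[r]!$ for $r\ge0$ and $X^{(r)}=0$ for $r<0$. $\mathbf U=U_q(\mathfrak{sl}_3)$ is the $\mathbb Q(q)$-algebra generated by $E_i,F_i,K_i^{\pm1}$, $i\in\{1,2\}$, with $K_1K_2=K_2K_1$, $K_iE_jK_i^{-1}=q^{a_{ij}}E_j$, $K_iF_jK_i^{-1}=q^{-a_{ij}}F_j$ ($a_{ii}=2$, $a_{12}=a_{21}=-1$), $E_iF_j-F_jE_i=\delta_{ij}\frac{K_i-K_i^{-1}}{q-q^{-1}}$, and for $i\ne j$ the Serre relations $E_jE_i^{(2)}-E_iE_jE_i+E_i^{(2)}E_j=0$, $F_jF_i^{(2)}-F_iF_jF_i+F_i^{(2)}F_j=0$. $\tau$ swaps $1$ and $2$. The parameter is $\varsigma=(\varsigma_1,\varsigma_2)\in\{(1,0),(0,1)\}$. $\mathbf U^\imath$ is the subalgebra of $\mathbf U$ generated by $B_i=F_i+q^{\varsigma_i}E_{\tau i}K_i^{-1}$, $k_i=K_iK_{\tau i}^{-1}$. $\psi^\imath$ is the $\mathbb Q$-algebra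 automorphism of $\mathbf U^\imath$ with $q\mapsto q^{-1}$, $B_i\mapsto B_i$, $k_i\mapsto k_i^{-1}$. $L(m,n)$ is the simple $\mathbf U$-module of highest weight $m\omega_1+n\omega_2$ with highest weight vector $\eta$; $\psi^\imath$ also denotes the anti-linear involution of $L(m,n)=\mathbf U^\imath\eta$ with $\psi^\imath(u\eta)=\psi^\imath(u)\eta$. For $b,c\ge0$ with $F_2^{(b)}F_1^{(c)}\eta\ne0$, $\mathfrak B_2^{(0,b,c)}\in L(m,n)$ is the icanonical basis element: the unique $\psi^\imath$-invariant element of $F_2^{(b)}F_1^{(c)}\eta+\sum_{\theta>0}q^{-1}\mathbb Z[q^{-1}]F_2^{(b-\theta)}F_1^{(c-\theta)}\eta$. The vectors $F_2^{(b-\theta)}F_1^{(c-\theta)}\eta$ are elements of Lusztig's canonical basis of $L(m,n)$ (when nonzero).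
   Formalization: In the closed formula n is replaced by n − ς₂ (no change for ς=(1,0)); as printed it fails for ς=(0,1), m=2, n=0, b=c=1, where the coefficient is 0 but the formula gives q^{-2}. The formula is asserted only for θ ≤ b, since for θ > b the vector is zero. *)

theory Defs
  imports
    "HOL-Library.Poly_Mapping"
    "HOL-Computational_Algebra.Computational_Algebra"
begin

section \<open>The field of rational functions\<close>

type_synonym Qq = "rat poly fract"

definition qv :: Qq where
  "qv = Fraction_Field.Fract [:0, 1:] 1"

definition ratc :: "rat \<Rightarrow> Qq" where
  "ratc r = Fraction_Field.Fract [:r:] 1"

text \<open>The value of a polynomial at \<open>q\<^sup>-\<^sup>1\<close>, and the automorphism of the field sending
  \<open>q\<close> to \<open>q\<^sup>-\<^sup>1\<close>; the lemmas below confirm that it is one.\<close>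

definition qsubst :: "rat poly \<Rightarrow> Qq" where
  "qsubst p = poly (map_poly ratc p) (inverse qv)"

definition qbar :: "Qq \<Rightarrow> Qq" where
  "qbar x = (THE y. \<exists>p s. s \<noteq> 0 \<and> x = Fraction_Field.Fract p s \<and> y = qsubst p / qsubst s)"

lemma ratc_simps [simp]:
  "ratc 0 = 0" "ratc 1 = 1" "ratc (a + b) = ratc a + ratc b" "ratc (a * b) = ratc a * ratc b"
  by (simp_all add: ratc_def Zero_fract_def One_fract_def one_pCons mult.commute)

lemma ratc_eq_0_iff [simp]: "ratc a = 0 \<longleftrightarrow> a = 0"
  by (simp add: ratc_def Zero_fract_def eq_fract)

lemma qv_nonzero [simp]: "qv \<noteq> 0"
  by (simp add: qv_def Zero_fract_def eq_fract)

lemma map_poly_ratc_add: "map_poly ratc (p + r) = map_poly ratc p + map_poly ratc r"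
  by (rule poly_eqI) (simp add: coeff_map_poly)

lemma map_poly_ratc_smult: "map_poly ratc (smult a p) = smult (ratc a) (map_poly ratc p)"
  by (rule poly_eqI) (simp add: coeff_map_poly)

lemma map_poly_ratc_mult: "map_poly ratc (p * r) = map_poly ratc p * map_poly ratc r"
  by (induction p)
    (simp_all add: map_poly_pCons map_poly_ratc_add map_poly_ratc_smult)

lemma poly_map_poly_ratc_qv: "poly (map_poly ratc p) qv = Fraction_Field.Fract p 1"
proof (induction p)
  case 0
  show ?case by (simp add: Zero_fract_def)
next
  case (pCons a p)
  have "poly (map_poly ratc (pCons a p)) qv = ratc a + qv * Fraction_Field.Fract p 1"
    by (simp add: map_poly_pCons pCons)
  also have "\<dots> = Fraction_Field.Fract (pCons a p) 1"
    by (simp add: ratc_def qv_def)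
  finally show ?case .
qed

lemma qsubst_simps [simp]:
  "qsubst 0 = 0" "qsubst 1 = 1" "qsubst [:0, 1:] = inverse qv"
  "qsubst (p + r) = qsubst p + qsubst r" "qsubst (p * r) = qsubst p * qsubst r"
  by (simp_all add: qsubst_def map_poly_ratc_add map_poly_ratc_mult map_poly_pCons)

lemma qsubst_eq_0_iff [simp]: "qsubst p = 0 \<longleftrightarrow> p = 0"
proof
  assume *: "qsubst p = 0"
  have "reflect_poly (map_poly ratc p) = map_poly ratc (reflect_poly p)"
    by (rule poly_eqI) (simp add: coeff_map_poly coeff_reflect_poly degree_map_poly)
  then have "Fraction_Field.Fract (reflect_poly p) 1 = poly (reflect_poly (map_poly ratc p)) qv"
    by (simp add: poly_map_poly_ratc_qv)
  also have "\<dots> = qv ^ degree p * qsubst p"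
    by (simp add: poly_reflect_poly_nz qsubst_def degree_map_poly)
  finally have "Fraction_Field.Fract (reflect_poly p) 1 = 0" by (simp add: *)
  then show "p = 0" by (simp add: Zero_fract_def eq_fract)
qed simp

lemma qbar_Fract:
  assumes s: "s \<noteq> 0"
  shows "qbar (Fraction_Field.Fract p s) = qsubst p / qsubst s"
  unfolding qbar_def
proof (rule the_equality)
  show "\<exists>p' s'. s' \<noteq> 0 \<and> Fraction_Field.Fract p s = Fraction_Field.Fract p' s' \<and>
      qsubst p / qsubst s = qsubst p' / qsubst s'"
    using s by blast
  fix y
  assume "\<exists>p' s'. s' \<noteq> 0 \<and> Fraction_Field.Fract p s = Fraction_Field.Fract p' s' \<and>
      y = qsubst p' / qsubst s'"
  then obtain a d where d: "d \<noteq> 0" and eq: "Fraction_Field.Fract p s = Fraction_Field.Fract a d"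
    and y: "y = qsubst a / qsubst d" by blast
  have "p * d = a * s" using eq s d by (simp add: eq_fract)
  then have "qsubst p * qsubst d = qsubst a * qsubst s"
    by (metis qsubst_simps(5))
  then show "y = qsubst p / qsubst s" using s d by (simp add: y frac_eq_eq)
qed

lemma qbar_simps [simp]:
  "qbar 0 = 0" "qbar 1 = 1" "qbar qv = inverse qv"
  "qbar (x + y) = qbar x + qbar y" "qbar (x * y) = qbar x * qbar y"
proof -
  show "qbar 0 = 0" "qbar 1 = 1" "qbar qv = inverse qv"
    by (simp_all add: Zero_fract_def One_fract_def qv_def qbar_Fract)
  obtain a b c d where "x = Fraction_Field.Fract a b" "b \<noteq> 0"
    "y = Fraction_Field.Fract c d" "d \<noteq> 0"
    by (metis Fract_cases)
  then show "qbar (x + y) = qbar x + qbar y" "qbar (x * y) = qbar x * qbar y"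
    by (simp_all add: qbar_Fract add_frac_eq)
qed

definition qinvZ :: "Qq set" where
  "qinvZ = {inverse qv * poly (map_poly of_int p) (inverse qv) | p :: int poly. True}"


section \<open>Quantum integers, factorials and binomial coefficients\<close>

definition qint :: "nat \<Rightarrow> int \<Rightarrow> Qq" where
  "qint t r = (qv powi (int t * r) - qv powi (- (int t * r))) / (qv powi (int t) - qv powi (- int t))"

definition qfact :: "nat \<Rightarrow> nat \<Rightarrow> Qq" where
  "qfact t r = (\<Prod>j = 1..r. qint t (int j))"

definition qbinom :: "nat \<Rightarrow> int \<Rightarrow> nat \<Rightarrow> Qq" where
  "qbinom t r s = (\<Prod>j<s. qint t (r - int j)) / qfact t s"


section \<open>The quantum group of type A2\<close>

datatype idx = One | Two

fun tau :: "idx \<Rightarrow> idx" where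
  "tau One = Two"
| "tau Two = One"

definition cartan :: "idx \<Rightarrow> idx \<Rightarrow> int" where
  "cartan i j = (if i = j then 2 else - 1)"

datatype ugen = GenE idx | GenF idx | GenK idx | GenKinv idx

text \<open>The free monoid on the generators, written additively so that finitely supported functions on
  it form, under convolution, the free associative algebra.\<close>

datatype uword = Word (letters: "ugen list")

instantiation uword :: monoid_add
begin

definition "0 = Word []"
definition "v + w = Word (letters v @ letters w)"

instance
  by standard (simp_all add: zero_uword_def plus_uword_def)

end

type_synonym freealg = "uword \<Rightarrow>\<^sub>0 Qq"

definition fscal :: "Qq \<Rightarrow> freealg" where
  "fscal c = Poly_Mapping.single 0 c"

definition fgen :: "ugen \<Rightarrow> freealg" where
  "fgen g = Poly_Mapping.single (Word [g]) 1"

abbreviation fE :: "idx \<Rightarrow> freealg" where "fE i \<equiv> fgen (GenE i)"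
abbreviation fF :: "idx \<Rightarrow> freealg" where "fF i \<equiv> fgen (GenF i)"
abbreviation fK :: "idx \<Rightarrow> freealg" where "fK i \<equiv> fgen (GenK i)"
abbreviation fKinv :: "idx \<Rightarrow> freealg" where "fKinv i \<equiv> fgen (GenKinv i)"

definition fserre :: "freealg \<Rightarrow> freealg \<Rightarrow> freealg" where
  "fserre x y = y * (fscal (1 / qfact 1 2) * x ^ 2) - x * y * x + (fscal (1 / qfact 1 2) * x ^ 2) * y"

text \<open>A relation \<open>lhs = rhs\<close> is recorded as the element \<open>lhs - rhs\<close>.\<close>

inductive_set urels :: "freealg set" where
  K_inv: "fK i * fKinv i - 1 \<in> urels"
| inv_K: "fKinv i * fK i - 1 \<in> urels"
| K_K: "fK One * fK Two - fK Two * fK One \<in> urels"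
| K_E: "fK i * fE j * fKinv i - fscal (qv powi cartan i j) * fE j \<in> urels"
| K_F: "fK i * fF j * fKinv i - fscal (qv powi (- cartan i j)) * fF j \<in> urels"
| E_F: "fE i * fF j - fF j * fE i
        - (if i = j then fscal (1 / (qv - inverse qv)) * (fK i - fKinv i) else 0) \<in> urels"
| serre_E: "i \<noteq> j \<Longrightarrow> fserre (fE i) (fE j) \<in> urels"
| serre_F: "i \<noteq> j \<Longrightarrow> fserre (fF i) (fF j) \<in> urels"

inductive_set uideal :: "freealg set" where
  zero: "0 \<in> uideal"
| step: "x \<in> uideal \<Longrightarrow> r \<in> urels \<Longrightarrow> x + a * r * b \<in> uideal"

lemma uideal_add: "y \<in> uideal \<Longrightarrow> x \<in> uideal \<Longrightarrow> x + y \<in> uideal"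
proof (induction y rule: uideal.induct)
  case zero
  then show ?case by simp
next
  case (step y r a b)
  then show ?case using uideal.step[of "x + y" r a b] by (simp add: add.assoc)
qed

lemma uideal_mult_left: "x \<in> uideal \<Longrightarrow> u * x \<in> uideal"
proof (induction x rule: uideal.induct)
  case zero
  then show ?case by (simp add: uideal.zero)
next
  case (step x r a b)
  then show ?case using uideal.step[of "u * x" r "u * a" b] by (simp add: algebra_simps)
qed

lemma uideal_mult_right: "x \<in> uideal \<Longrightarrow> x * u \<in> uideal"
proof (induction x rule: uideal.induct)
  case zero
  then show ?case by (simp add: uideal.zero)
next
  case (step x r a b)
  then show ?case using uideal.step[of "x * u" r a "b * u"] by (simp add: algebra_simps)
qed

lemma uideal_uminus: "x \<in> uideal \<Longrightarrow> - x \<in> uideal"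
  using uideal_mult_left[of x "- 1"] by simp

text \<open>The counit of the Hopf algebra, used only to see that the quotient is not the zero ring.\<close>

fun counit_gen :: "ugen \<Rightarrow> Qq" where
  "counit_gen (GenE i) = 0"
| "counit_gen (GenF i) = 0"
| "counit_gen (GenK i) = 1"
| "counit_gen (GenKinv i) = 1"

definition counit_word :: "uword \<Rightarrow> Qq" where
  "counit_word w = prod_list (map counit_gen (letters w))"

definition counit :: "freealg \<Rightarrow> Qq" where
  "counit p = (\<Sum>w\<in>Poly_Mapping.keys p. Poly_Mapping.lookup p w * counit_word w)"

lemma counit_superset:
  "finite A \<Longrightarrow> Poly_Mapping.keys p \<subseteq> A \<Longrightarrow>
    counit p = (\<Sum>w\<in>A. Poly_Mapping.lookup p w * counit_word w)"
  unfolding counit_def by (rule sum.mono_neutral_left) (auto simp: in_keys_iff)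

lemma counit_add: "counit (p + r) = counit p + counit r"
proof -
  let ?A = "Poly_Mapping.keys p \<union> Poly_Mapping.keys r"
  have "counit (p + r) = (\<Sum>w\<in>?A. Poly_Mapping.lookup (p + r) w * counit_word w)"
    by (rule counit_superset) (use Poly_Mapping.keys_add[of p r] in auto)
  moreover have "counit p = (\<Sum>w\<in>?A. Poly_Mapping.lookup p w * counit_word w)"
    by (rule counit_superset) auto
  moreover have "counit r = (\<Sum>w\<in>?A. Poly_Mapping.lookup r w * counit_word w)"
    by (rule counit_superset) auto
  ultimately show ?thesis by (simp add: lookup_add distrib_right sum.distrib)
qed

lemma counit_single [simp]: "counit (Poly_Mapping.single w c) = c * counit_word w"
  by (subst counit_superset[of "{w}"]) auto

lemma counit_0 [simp]: "counit 0 = 0"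
  by (simp add: counit_def)

lemma freealg_induct [case_names zero plus]:
  assumes "P (0 :: freealg)"
    and "\<And>w c p. P p \<Longrightarrow> P (Poly_Mapping.single w c + p)"
  shows "P p"
proof (induction p rule: Poly_Mapping.update_induct)
  case const
  show ?case by (rule assms(1))
next
  case (update p w c)
  have "Poly_Mapping.update w c p = Poly_Mapping.single w c + p"
    by (rule poly_mapping_eqI)
       (use update in \<open>auto simp: lookup_update lookup_add lookup_single in_keys_iff when_def\<close>)
  then show ?case using assms(2)[OF update(3)] by simp
qed

lemma counit_word_plus: "counit_word (v + w) = counit_word v * counit_word w"
  by (simp add: counit_word_def plus_uword_def)

lemma counit_single_mult: "counit (Poly_Mapping.single w c * r) = c * counit_word w * counit r"
  by (induction r rule: freealg_induct)
     (simp_all add: distrib_left counit_add mult_single counit_word_plus algebra_simps)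

lemma counit_mult: "counit (p * r) = counit p * counit r"
  by (induction p rule: freealg_induct)
     (simp_all add: distrib_right counit_add counit_single_mult)

lemma counit_diff: "counit (p - r) = counit p - counit r"
  using counit_add[of "p - r" r] by simp

lemma counit_1 [simp]: "counit 1 = 1"
  unfolding single_one[symmetric] by (simp only: counit_single) (simp add: counit_word_def zero_uword_def)

lemma counit_fgen [simp]: "counit (fgen g) = counit_gen g"
  by (simp add: fgen_def counit_word_def)

lemma counit_urels: "r \<in> urels \<Longrightarrow> counit r = 0"
  by (induction rule: urels.induct)
     (auto simp: counit_diff counit_mult counit_add fserre_def power2_eq_square)

lemma counit_uideal: "x \<in> uideal \<Longrightarrow> counit x = 0"
  by (induction rule: uideal.induct) (simp_all add: counit_add counit_mult counit_urels)

definition ucong :: "freealg \<Rightarrow> freealg \<Rightarrow> bool" where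
  "ucong x y \<longleftrightarrow> x - y \<in> uideal"

lemma ucong_equivp: "equivp ucong"
proof (rule equivpI)
  show "reflp ucong" by (rule reflpI) (simp add: ucong_def uideal.zero)
  show "symp ucong"
    by (rule sympI) (use uideal_uminus in \<open>fastforce simp: ucong_def\<close>)
  show "transp ucong"
  proof (rule transpI)
    fix x y z assume "ucong x y" "ucong y z"
    then show "ucong x z"
      using uideal_add[of "y - z" "x - y"] by (simp add: ucong_def)
  qed
qed

quotient_type Usl3 = freealg / ucong
  by (rule ucong_equivp)

instantiation Usl3 :: ring_1
begin

lift_definition zero_Usl3 :: Usl3 is 0 .
lift_definition one_Usl3 :: Usl3 is 1 .
lift_definition plus_Usl3 :: "Usl3 \<Rightarrow> Usl3 \<Rightarrow> Usl3" is "(+)"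
proof -
  fix x x' y y' assume "ucong x x'" "ucong y y'"
  then show "ucong (x + y) (x' + y')"
    using uideal_add[of "y - y'" "x - x'"] by (simp add: ucong_def algebra_simps)
qed
lift_definition uminus_Usl3 :: "Usl3 \<Rightarrow> Usl3" is uminus
proof -
  fix x x' assume "ucong x x'"
  then show "ucong (- x) (- x')"
    using uideal_uminus[of "x - x'"] by (simp add: ucong_def)
qed
lift_definition minus_Usl3 :: "Usl3 \<Rightarrow> Usl3 \<Rightarrow> Usl3" is "(-)"
proof -
  fix x x' y y' assume "ucong x x'" "ucong y y'"
  then show "ucong (x - y) (x' - y')"
    using uideal_add[of "- (y - y')" "x - x'"] uideal_uminus[of "y - y'"]
    by (simp add: ucong_def algebra_simps)
qed
lift_definition times_Usl3 :: "Usl3 \<Rightarrow> Usl3 \<Rightarrow> Usl3" is "(*)"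
proof -
  fix x x' y y' assume "ucong x x'" "ucong y y'"
  then show "ucong (x * y) (x' * y')"
    using uideal_add[OF uideal_mult_right[of "x - x'" y] uideal_mult_left[of "y - y'" x']]
    by (simp add: ucong_def algebra_simps)
qed

instance
proof
  fix a b c :: Usl3
  have refl: "ucong x x" for x by (simp add: ucong_def uideal.zero)
  show "a + b + c = a + (b + c)" by transfer (simp add: refl add.assoc)
  show "a + b = b + a" by transfer (simp add: refl add.commute)
  show "0 + a = a" by transfer (simp add: refl)
  show "- a + a = 0" by transfer (simp add: refl)
  show "a - b = a + - b" by transfer (simp add: refl)
  show "a * b * c = a * (b * c)" by transfer (simp add: refl mult.assoc)
  show "(a + b) * c = a * c + b * c" by transfer (simp add: refl distrib_right)
  show "a * (b + c) = a * b + a * c" by transfer (simp add: refl distrib_left)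
  show "1 * a = a" by transfer (simp add: refl)
  show "a * 1 = a" by transfer (simp add: refl)
  show "(0 :: Usl3) \<noteq> 1"
  proof (transfer, rule notI)
    assume "ucong 0 1"
    then show False using counit_uideal[of "0 - 1"] by (simp add: ucong_def counit_diff del: diff_0)
  qed
qed

end

lift_definition uscale :: "Qq \<Rightarrow> Usl3 \<Rightarrow> Usl3" is "\<lambda>c x. fscal c * x"
proof -
  fix c x x' assume "ucong x x'"
  then show "ucong (fscal c * x) (fscal c * x')"
    using uideal_mult_left[of "x - x'" "fscal c"] by (simp add: ucong_def algebra_simps)
qed

lift_definition ugen_of :: "ugen \<Rightarrow> Usl3" is fgen .

abbreviation EE :: "idx \<Rightarrow> Usl3" where "EE i \<equiv> ugen_of (GenE i)"
abbreviation FF :: "idx \<Rightarrow> Usl3" where "FF i \<equiv> ugen_of (GenF i)"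
abbreviation KK :: "idx \<Rightarrow> Usl3" where "KK i \<equiv> ugen_of (GenK i)"
abbreviation Kinv :: "idx \<Rightarrow> Usl3" where "Kinv i \<equiv> ugen_of (GenKinv i)"

definition divpow :: "Usl3 \<Rightarrow> int \<Rightarrow> Usl3" where
  "divpow x r = (if r < 0 then 0 else uscale (1 / qfact 1 (nat r)) (x ^ nat r))"


section \<open>The iquantum group and its bar involution\<close>

definition Bgen :: "(idx \<Rightarrow> nat) \<Rightarrow> idx \<Rightarrow> Usl3" where
  "Bgen \<sigma> i = FF i + uscale (qv ^ \<sigma> i) (EE (tau i) * Kinv i)"

definition kgen :: "idx \<Rightarrow> Usl3" where
  "kgen i = KK i * Kinv (tau i)"

inductive_set Uiota :: "(idx \<Rightarrow> nat) \<Rightarrow> Usl3 set" for \<sigma> where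
  one: "1 \<in> Uiota \<sigma>"
| B: "Bgen \<sigma> i \<in> Uiota \<sigma>"
| k: "kgen i \<in> Uiota \<sigma>"
| add: "x \<in> Uiota \<sigma> \<Longrightarrow> y \<in> Uiota \<sigma> \<Longrightarrow> x + y \<in> Uiota \<sigma>"
| mult: "x \<in> Uiota \<sigma> \<Longrightarrow> y \<in> Uiota \<sigma> \<Longrightarrow> x * y \<in> Uiota \<sigma>"
| scale: "x \<in> Uiota \<sigma> \<Longrightarrow> uscale c x \<in> Uiota \<sigma>"

text \<open>Only the restriction of \<open>\<psi>\<close> to the subalgebra matters. The inverse of \<open>kgen i\<close> is
  \<open>KK (tau i) * Kinv i\<close>, that is, \<open>kgen (tau i)\<close>.\<close>

definition is_psi_iota :: "(idx \<Rightarrow> nat) \<Rightarrow> (Usl3 \<Rightarrow> Usl3) \<Rightarrow> bool" where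
  "is_psi_iota \<sigma> \<psi> \<longleftrightarrow>
     bij_betw \<psi> (Uiota \<sigma>) (Uiota \<sigma>) \<and>
     \<psi> 1 = 1 \<and>
     (\<forall>x\<in>Uiota \<sigma>. \<forall>y\<in>Uiota \<sigma>. \<psi> (x + y) = \<psi> x + \<psi> y \<and> \<psi> (x * y) = \<psi> x * \<psi> y) \<and>
     (\<forall>c. \<forall>x\<in>Uiota \<sigma>. \<psi> (uscale c x) = uscale (qbar c) (\<psi> x)) \<and>
     (\<forall>i. \<psi> (Bgen \<sigma> i) = Bgen \<sigma> i \<and> \<psi> (kgen i) = kgen (tau i))"


section \<open>Simple highest weight modules\<close>

locale U_module = vector_space scale
  for scale :: "Qq \<Rightarrow> 'v::ab_group_add \<Rightarrow> 'v" +
  fixes act :: "Usl3 \<Rightarrow> 'v \<Rightarrow> 'v"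
  assumes act_one: "act 1 v = v"
    and act_mult: "act (x * y) v = act x (act y v)"
    and act_add_left: "act (x + y) v = act x v + act y v"
    and act_add_right: "act x (v + w) = act x v + act x w"
    and act_uscale: "act (uscale a x) v = scale a (act x v)"

locale simple_hw_module = U_module scale act
  for scale :: "Qq \<Rightarrow> 'v::ab_group_add \<Rightarrow> 'v" and act :: "Usl3 \<Rightarrow> 'v \<Rightarrow> 'v" +
  fixes \<eta> :: 'v and m n :: nat
  assumes simple: "subspace S \<Longrightarrow> (\<And>x v. v \<in> S \<Longrightarrow> act x v \<in> S) \<Longrightarrow> S = {0} \<or> S = UNIV"
    and hw_nonzero: "\<eta> \<noteq> 0"
    and hw_E: "act (EE i) \<eta> = 0"
    and hw_K1: "act (KK One) \<eta> = scale (qv ^ m) \<eta>"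
    and hw_K2: "act (KK Two) \<eta> = scale (qv ^ n) \<eta>"

definition is_module_psi_iota ::
  "(idx \<Rightarrow> nat) \<Rightarrow> (Usl3 \<Rightarrow> Usl3) \<Rightarrow> (Qq \<Rightarrow> 'v::ab_group_add \<Rightarrow> 'v) \<Rightarrow> (Usl3 \<Rightarrow> 'v \<Rightarrow> 'v) \<Rightarrow>
    'v \<Rightarrow> ('v \<Rightarrow> 'v) \<Rightarrow> bool" where
  "is_module_psi_iota \<sigma> \<psi> scale act \<eta> \<Psi> \<longleftrightarrow>
     (\<forall>v w. \<Psi> (v + w) = \<Psi> v + \<Psi> w) \<and>
     (\<forall>a v. \<Psi> (scale a v) = scale (qbar a) (\<Psi> v)) \<and>
     (\<forall>v. \<Psi> (\<Psi> v) = v) \<and>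
     (\<forall>u\<in>Uiota \<sigma>. \<Psi> (act u \<eta>) = act (\<psi> u) \<eta>)"


section \<open>The icanonical basis element\<close>

definition Fvec :: "(Usl3 \<Rightarrow> 'v \<Rightarrow> 'v) \<Rightarrow> 'v \<Rightarrow> int \<Rightarrow> int \<Rightarrow> 'v" where
  "Fvec act \<eta> b c = act (divpow (FF Two) b * divpow (FF One) c) \<eta>"

text \<open>The summation stops at \<open>c\<close> because \<open>Fvec act \<eta> (b - \<theta>) (c - \<theta>)\<close> vanishes for
  \<open>\<theta> > c\<close>.\<close>

definition icanonical ::
  "(Qq \<Rightarrow> 'v::ab_group_add \<Rightarrow> 'v) \<Rightarrow> (Usl3 \<Rightarrow> 'v \<Rightarrow> 'v) \<Rightarrow> 'v \<Rightarrow> ('v \<Rightarrow> 'v) \<Rightarrow> nat \<Rightarrow> nat \<Rightarrow> 'v" where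
  "icanonical scale act \<eta> \<Psi> b c = (THE v. \<Psi> v = v \<and>
     (\<exists>a. (\<forall>\<theta>. a \<theta> \<in> qinvZ) \<and>
        v = Fvec act \<eta> (int b) (int c) +
            (\<Sum>\<theta> = 1..c. scale (a \<theta>) (Fvec act \<eta> (int b - int \<theta>) (int c - int \<theta>)))))"

text \<open>The coefficient of \<open>Fvec act \<eta> (b - \<theta>) (c - \<theta>)\<close>. The library's \<open>representation\<close> gives
  coordinates with respect to the linearly independent set of those of these vectors that are
  nonzero, and gives 0 for \<open>\<theta> > b\<close>, where the vector itself is zero.\<close>

definition icoeff ::
  "(Qq \<Rightarrow> 'v::ab_group_add \<Rightarrow> 'v) \<Rightarrow> (Usl3 \<Rightarrow> 'v \<Rightarrow> 'v) \<Rightarrow> 'v \<Rightarrow> ('v \<Rightarrow> 'v) \<Rightarrow>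
    nat \<Rightarrow> nat \<Rightarrow> nat \<Rightarrow> Qq" where
  "icoeff scale act \<eta> \<Psi> b c \<theta> =
     module.representation scale
       ((\<lambda>t. Fvec act \<eta> (int b - int t) (int c - int t)) ` {0..c} - {0})
       (icanonical scale act \<eta> \<Psi> b c)
       (Fvec act \<eta> (int b - int \<theta>) (int c - int \<theta>))"

text \<open>In the first exponent \<open>(c - 2x)(c - 1 - 2m)\<close> is even, so that \<open>div\<close> is exact.

  The coefficients are the values of this expression with \<open>n\<close> replaced by \<open>n - \<sigma> Two\<close> (a change
  only for the parameter \<open>(0, 1)\<close>): with \<open>\<alpha> = m - n + b - 2c + \<sigma> Two\<close> the top entry of the second
  binomial then is \<open>m - \<alpha> - 2x\<close> and the last exponent is \<open>x (1 - c - \<alpha>)\<close>. The shift is needed: for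
  the parameter \<open>(0, 1)\<close>, \<open>m = 2\<close>, \<open>n = 0\<close> and \<open>b = c = 1\<close>, the invariant vector \<open>B\<^sub>2 B\<^sub>1 \<eta>\<close> equals
  \<open>F\<^sub>2 F\<^sub>1 \<eta> + (q + q\<^sup>-\<^sup>1) \<eta>\<close>, so \<open>F\<^sub>2 F\<^sub>1 \<eta>\<close> is itself invariant and the coefficient of \<open>\<eta>\<close> is 0, while
  the unshifted expression gives \<open>q\<^sup>-\<^sup>2\<close>.\<close>

definition Omega_formula :: "int \<Rightarrow> int \<Rightarrow> int \<Rightarrow> nat \<Rightarrow> nat \<Rightarrow> Qq" where
  "Omega_formula \<gamma> m n b c =
     (\<Sum>x = 0..c div 2.
        qbinom 2 (\<gamma> + int x - 1) x *
        qbinom 1 (n - int b + 2 * int c - 2 * int x) (c - 2 * x) *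
        qv powi ((int c - 2 * int x) * (int c - 1 - 2 * m) div 2) *
        qv powi (int x * (- m + n - int b + int c + 1)))"

end

theory Submission
  imports Defs
begin

text \<open>
  Put \<open>e t = F\<^sub>2\<^bsup>(b-t)\<^esup> F\<^sub>1\<^bsup>(c-t)\<^esup> \<eta>\<close>. The vectors \<open>f t = B\<^sub>2\<^bsup>(b-t)\<^esup> B\<^sub>1\<^bsup>(c-t)\<^esup> \<eta>\<close> are
  fixed by the bar involution, and as \<open>F\<^sub>2\<close> and \<open>E\<^sub>1 K\<^sub>2\<^sup>-\<^sup>1\<close> q-commute, they expand unitriangularly
  in the \<open>e t\<close> with explicit q-binomial coefficients. An element that is a bar-fixed combination of the
  \<open>e t\<close> with coefficients in \<open>q\<^sup>-\<^sup>1 \<int>[q\<^sup>-\<^sup>1]\<close> is zero, so the icanonical basis element is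
  \<open>\<Sum>t. \<Omega> t e t\<close> as soon as \<open>\<Omega> t\<close> lies in \<open>q\<^sup>-\<^sup>1 \<int>[q\<^sup>-\<^sup>1]\<close> for \<open>t > 0\<close> and this sum is a combination
  of the \<open>f t\<close> with bar-invariant coefficients. These turn out to be
  \<open>\<Prod>i<t. - [\<alpha> + 2 i] / [i + 1]\<close>. With \<open>Q = q\<^sup>-\<^sup>2\<close>, \<open>g = Q\<^sup>\<gamma>\<close> and \<open>N = n - b + c - \<sigma> Two\<close>,
  the generating function of \<open>q\<^bsup>t (t + 1) / 2\<^esup> \<Omega> t\<close> is
  \<open>1 / ((z\<^sup>2; Q\<^sup>2)\<^sub>\<gamma> (g z; Q)\<^sub>N\<^sub>+\<^sub>1)\<close>, and the required identity holds because both
  sides solve the q-difference equation \<open>(1 + g z) (1 - g Q\<^bsup>N+1\<^esup> z) h(Q z) = (1 - z\<^sup>2) h(z)\<close>.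
\<close>

section \<open>A q-series identity\<close>

text \<open>This is \<open>(w; Q)_k / (Q; Q)_k\<close>. For \<open>w = Q^n\<close> it is a Gaussian
  binomial coefficient; a free \<open>w\<close> also covers negative top entries.\<close>

definition gauss_coeff :: "'a::field \<Rightarrow> 'a \<Rightarrow> nat \<Rightarrow> 'a" where
  "gauss_coeff Q w k = (\<Prod>j<k. (1 - w * Q ^ j) / (1 - Q ^ Suc j))"

lemma gauss_coeff_0 [simp]: "gauss_coeff Q w 0 = 1"
  by (simp add: gauss_coeff_def)

lemma gauss_coeff_one: "gauss_coeff Q 1 k = (if k = 0 then 1 else 0)"
  by (cases k) (simp_all add: gauss_coeff_def prod.lessThan_Suc_shift del: prod.lessThan_Suc)

lemma gauss_coeff_Suc:
  assumes "Q ^ Suc k \<noteq> 1"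
  shows "(1 - Q ^ Suc k) * gauss_coeff Q w (Suc k) = (1 - w * Q ^ k) * gauss_coeff Q w k"
  using assms by (simp add: gauss_coeff_def)

text \<open>Both sides are \<open>(w; Q)_(k+1) / (Q; Q)_k\<close>.\<close>

lemma gauss_coeff_shift:
  "(1 - w) * gauss_coeff Q (w * Q) k = (1 - w * Q ^ k) * gauss_coeff Q w k"
proof (induction k)
  case (Suc k)
  have "(1 - w) * gauss_coeff Q (w * Q) (Suc k) =
      ((1 - w) * gauss_coeff Q (w * Q) k) * ((1 - w * Q ^ Suc k) / (1 - Q ^ Suc k))"
    by (simp add: gauss_coeff_def mult.assoc)
  also have "\<dots> = (1 - w * Q ^ Suc k) * gauss_coeff Q w (Suc k)"
    unfolding Suc.IH by (simp add: gauss_coeff_def)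
  finally show ?case .
qed simp

text \<open>The q-Pascal rule in the parameter \<open>w\<close>, from which integrality will
  follow.\<close>

lemma gauss_coeff_pascal:
  assumes "Q ^ Suc k \<noteq> 1"
  shows "gauss_coeff Q (w * Q) (Suc k) =
    gauss_coeff Q w (Suc k) + w * gauss_coeff Q (w * Q) k"
proof -
  let ?d = "1 - Q ^ Suc k"
  have "gauss_coeff Q w (Suc k) * ?d = (1 - w) * gauss_coeff Q (w * Q) k"
    using gauss_coeff_Suc[OF assms, of w] gauss_coeff_shift[of w Q k] by (simp add: mult.commute)
  moreover have "gauss_coeff Q (w * Q) (Suc k) * ?d = (1 - w * Q * Q ^ k) * gauss_coeff Q (w * Q) k"
    using gauss_coeff_Suc[OF assms, of "w * Q"] by (simp add: mult.commute)
  moreover have "(1 - w * Q * Q ^ k) * gauss_coeff Q (w * Q) k =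
      (1 - w) * gauss_coeff Q (w * Q) k + w * gauss_coeff Q (w * Q) k * ?d"
    by (simp add: algebra_simps)
  ultimately have "gauss_coeff Q (w * Q) (Suc k) * ?d =
      (gauss_coeff Q w (Suc k) + w * gauss_coeff Q (w * Q) k) * ?d"
    by (simp only: distrib_right)
  then show ?thesis using assms by simp
qed

text \<open>By the q-binomial theorem this is \<open>(w a z; Q)\<^sub>\<infinity> / (a z; Q)\<^sub>\<infinity>\<close>; for \<open>w = Q\<^sup>n\<close> it is the
  reciprocal of \<open>\<Prod>i<n. 1 - a Q\<^sup>i z\<close>.\<close>

definition gauss_series :: "'a::field \<Rightarrow> 'a \<Rightarrow> 'a \<Rightarrow> 'a fps" where
  "gauss_series Q w a = Abs_fps (\<lambda>k. a ^ k * gauss_coeff Q w k)"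

definition dilate :: "'a::field \<Rightarrow> 'a fps \<Rightarrow> 'a fps" where
  "dilate Q f = f oo (fps_const Q * fps_X)"

lemma dilate_nth: "fps_nth (dilate Q f) n = Q ^ n * fps_nth f n"
  by (simp add: dilate_def fps_compose_linear)

lemma dilate_mult: "dilate Q (f * h) = dilate Q f * dilate Q h"
  unfolding dilate_def by (rule fps_compose_mult_distrib) simp

lemma linear_mult_nth:
  fixes a :: "'a::field"
  shows "fps_nth ((1 - fps_const a * fps_X) * f) n = fps_nth f n - (if n = 0 then 0 else a * fps_nth f (n - 1))"
  by (cases n) (simp_all add: left_diff_distrib mult.assoc)

text \<open>In product form, replacing \<open>z\<close> by \<open>Q z\<close> removes the first
  factor of \<open>(w a z; Q)_inf\<close> and of \<open>(a z; Q)_inf\<close>. On coefficients this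
  is \<open>gauss_coeff_Suc\<close>.\<close>

lemma gauss_series_dilate:
  assumes "\<And>n. Q ^ Suc n \<noteq> 1"
  shows "(1 - fps_const (w * a) * fps_X) * dilate Q (gauss_series Q w a) =
    (1 - fps_const a * fps_X) * gauss_series Q w a"
proof (rule fps_ext)
  fix n
  show "fps_nth ((1 - fps_const (w * a) * fps_X) * dilate Q (gauss_series Q w a)) n =
    fps_nth ((1 - fps_const a * fps_X) * gauss_series Q w a) n"
  proof (cases n)
    case (Suc k)
    have "a ^ Suc k * ((1 - Q ^ Suc k) * gauss_coeff Q w (Suc k)) =
        a ^ Suc k * ((1 - w * Q ^ k) * gauss_coeff Q w k)"
      by (subst gauss_coeff_Suc[OF assms]) simp
    then show ?thesis
      by (simp add: Suc linear_mult_nth dilate_nth gauss_series_def algebra_simps)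
  qed (simp add: linear_mult_nth dilate_nth gauss_series_def)
qed

text \<open>The product \<open>w a\<close> is unchanged, so the numerator stays the same while the
  denominator gains the factor \<open>1 - a z / Q\<close>.\<close>

lemma gauss_series_shift:
  assumes "\<And>n. Q ^ Suc n \<noteq> 1" "Q \<noteq> 0"
  shows "(1 - fps_const (a / Q) * fps_X) * gauss_series Q (w * Q) (a / Q) = gauss_series Q w a"
proof (rule fps_ext)
  fix n
  show "fps_nth ((1 - fps_const (a / Q) * fps_X) * gauss_series Q (w * Q) (a / Q)) n =
    fps_nth (gauss_series Q w a) n"
  proof (cases n)
    case (Suc k)
    have d: "1 - Q ^ Suc k \<noteq> 0" using assms(1)[of k] by simp
    let ?h = "gauss_coeff Q (w * Q) k"
    have "(gauss_coeff Q (w * Q) (Suc k) - ?h) * (1 - Q ^ Suc k) = Q ^ Suc k * ((1 - w) * ?h)"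
      using gauss_coeff_Suc[OF assms(1)[of k], of "w * Q"] by (simp add: algebra_simps)
    also have "\<dots> = (Q ^ Suc k * gauss_coeff Q w (Suc k)) * (1 - Q ^ Suc k)"
      using gauss_coeff_Suc[OF assms(1)[of k], of w] gauss_coeff_shift[of w Q k] by (simp add: ac_simps)
    finally have "gauss_coeff Q (w * Q) (Suc k) - ?h = Q ^ Suc k * gauss_coeff Q w (Suc k)"
      using d by simp
    then have "(a / Q) ^ Suc k * (gauss_coeff Q (w * Q) (Suc k) - ?h) =
        a ^ Suc k * gauss_coeff Q w (Suc k)"
      using assms(2) by (simp add: power_divide)
    then show ?thesis
      by (simp add: Suc linear_mult_nth gauss_series_def algebra_simps)
  qed (simp add: linear_mult_nth gauss_series_def)
qed

section \<open>The q-difference equation and its solution in product form\<close>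

definition omega_eq_defect :: "'a::field \<Rightarrow> 'a \<Rightarrow> 'a \<Rightarrow> 'a fps \<Rightarrow> 'a fps" where
  "omega_eq_defect Q g u f =
     (1 - fps_const (- g) * fps_X) * ((1 - fps_const (u * g) * fps_X) * dilate Q f)
     - (1 - fps_X ^ 2) * f"

lemma omega_eq_defect_1:
  "fps_nth (omega_eq_defect Q g u f) (Suc 0) =
     (Q - 1) * fps_nth f (Suc 0) + (g - u * g) * fps_nth f 0"
  by (simp add: omega_eq_defect_def linear_mult_nth dilate_nth left_diff_distrib
      fps_X_power_mult_nth algebra_simps)

lemma omega_eq_defect_Suc_Suc:
  "fps_nth (omega_eq_defect Q g u f) (Suc (Suc n)) =
     (Q ^ Suc (Suc n) - 1) * fps_nth f (Suc (Suc n)) + (g - u * g) * Q ^ Suc n * fps_nth f (Suc n)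
     + (1 - u * g\<^sup>2 * Q ^ n) * fps_nth f n"
  by (simp add: omega_eq_defect_def linear_mult_nth dilate_nth left_diff_distrib
      fps_X_power_mult_nth power2_eq_square algebra_simps)

text \<open>The n-th coefficient carries the nonzero factor \<open>Q^n - 1\<close>, so the equation
  determines it from the earlier ones. Only orders up to \<open>R\<close> are compared because a
  truncated sum will be inserted.\<close>

lemma omega_eq_defect_unique:
  assumes Q: "\<And>n. Q ^ Suc n \<noteq> 1"
    and f0: "fps_nth f 0 = fps_nth h 0"
    and eq: "\<And>k. k \<le> R \<Longrightarrow> fps_nth (omega_eq_defect Q g u f) k = fps_nth (omega_eq_defect Q g u h) k"
    and "n \<le> R"
  shows "fps_nth f n = fps_nth h n"
  using \<open>n \<le> R\<close>
proof (induction n rule: less_induct)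
  case (less n)
  consider "n = 0" | "n = Suc 0" | k where "n = Suc (Suc k)"
    by (metis not0_implies_Suc)
  then show ?case
  proof cases
    case 1
    then show ?thesis using f0 by simp
  next
    case 2
    then show ?thesis
      using eq[of n] less.prems Q[of 0] f0 by (simp add: omega_eq_defect_1)
  next
    case 3
    then have "fps_nth f (Suc k) = fps_nth h (Suc k)" "fps_nth f k = fps_nth h k"
      using less by simp_all
    then show ?thesis
      using eq[of n] less.prems Q[of "Suc k"] 3 by (simp add: omega_eq_defect_Suc_Suc)
  qed
qed

text \<open>The q-binomial series \<open>(w z^2; Q^2)_inf / (z^2; Q^2)_inf\<close>; for
  \<open>w = Q^(2 \<gamma>)\<close> it is the factor \<open>1 / (z^2; Q^2)_\<gamma>\<close> of the
  generating function.\<close>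

definition even_series :: "'a::field \<Rightarrow> 'a \<Rightarrow> 'a fps" where
  "even_series Q w = Abs_fps (\<lambda>n. if even n then gauss_coeff (Q\<^sup>2) w (n div 2) else 0)"

text \<open>This is the dilation equation for base \<open>Q^2\<close> in the variable
  \<open>z^2\<close>; odd coefficients vanish on both sides.\<close>

lemma even_series_dilate:
  assumes Q: "\<And>n. Q ^ Suc n \<noteq> 1"
  shows "(1 - fps_const w * fps_X ^ 2) * dilate Q (even_series Q w) = (1 - fps_X ^ 2) * even_series Q w"
proof (rule fps_ext)
  fix n
  consider "n = 0" | "n = Suc 0" | k where "n = Suc (Suc k)"
    by (metis not0_implies_Suc)
  then show "fps_nth ((1 - fps_const w * fps_X ^ 2) * dilate Q (even_series Q w)) n =
      fps_nth ((1 - fps_X ^ 2) * even_series Q w) n"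
  proof cases
    case 3
    show ?thesis
    proof (cases "even k")
      case True
      then obtain j where k: "k = 2 * j" by (elim evenE)
      have e: "(Q\<^sup>2) ^ i = Q ^ (2 * i)" for i
        by (simp only: power_mult)
      have "(Q\<^sup>2) ^ Suc j \<noteq> 1"
        using Q[of "Suc (2 * j)"] by (simp add: e del: power_Suc)
      from gauss_coeff_Suc[OF this, of w, unfolded e]
      have *: "gauss_coeff (Q\<^sup>2) w (Suc j) * Q ^ (2 * Suc j) - w * gauss_coeff (Q\<^sup>2) w j * Q ^ (2 * j)
          = gauss_coeff (Q\<^sup>2) w (Suc j) - gauss_coeff (Q\<^sup>2) w j"
        by (simp add: algebra_simps)
      show ?thesis
        using * by (simp add: 3 k left_diff_distrib dilate_nth even_series_def fps_X_power_mult_nth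
            mult.assoc mult.commute[of "gauss_coeff _ _ _"])
    next
      case False
      then show ?thesis
        by (simp add: 3 left_diff_distrib dilate_nth even_series_def fps_X_power_mult_nth mult.assoc)
    qed
  qed (simp_all add: left_diff_distrib dilate_nth even_series_def fps_X_power_mult_nth mult.assoc)
qed

definition omega_series :: "'a::field \<Rightarrow> 'a \<Rightarrow> 'a \<Rightarrow> 'a fps" where
  "omega_series Q g u = even_series Q (g\<^sup>2) * gauss_series Q u g"

text \<open>Multiplying by \<open>1 - g z\<close> completes \<open>1 + g z\<close> to
  \<open>1 - g^2 z^2\<close>. Then the dilation equations of both factors apply, and
  \<open>1 - g z\<close> is cancelled again.\<close>

lemma omega_series_defect:
  fixes Q :: "'a::field"
  assumes Q: "\<And>n. Q ^ Suc n \<noteq> 1"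
  shows "omega_eq_defect Q g u (omega_series Q g u) = 0"
proof -
  let ?A = "even_series Q (g\<^sup>2)" and ?B = "gauss_series Q u g"
  let ?l = "\<lambda>a::'a. 1 - fps_const a * fps_X"
  have lin: "?l (- g) * ?l g = 1 - fps_const (g\<^sup>2) * fps_X ^ 2"
    by (simp add: power2_eq_square algebra_simps flip: fps_const_neg fps_const_mult)
  have "?l g * (?l (- g) * (?l (u * g) * dilate Q (?A * ?B))) =
      (?l (- g) * ?l g * dilate Q ?A) * (?l (u * g) * dilate Q ?B)"
    by (simp add: dilate_mult ac_simps)
  also have "\<dots> = ((1 - fps_X ^ 2) * ?A) * (?l g * ?B)"
    unfolding lin even_series_dilate[OF Q] gauss_series_dilate[OF Q] ..
  finally have "?l g * (?l (- g) * (?l (u * g) * dilate Q (?A * ?B))) = ?l g * ((1 - fps_X ^ 2) * (?A * ?B))"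
    by (simp add: ac_simps)
  moreover have "?l g \<noteq> 0"
  proof
    assume "?l g = 0"
    then have "fps_nth (?l g) 0 = 0" by simp
    then show False by simp
  qed
  ultimately show ?thesis
    by (simp add: omega_eq_defect_def omega_series_def)
qed

section \<open>A second solution, summed by telescoping\<close>

definition inv_coeff :: "'a::field \<Rightarrow> 'a \<Rightarrow> nat \<Rightarrow> 'a" where
  "inv_coeff Q g r = (\<Prod>i<r. - ((1 - g\<^sup>2 * Q ^ (2 * i)) / (g * Q ^ i * (1 - Q ^ Suc i))))"

text \<open>Up to powers of \<open>q\<close>, its coefficients will be the coordinates of the
  invariant vector \<open>f r\<close> in the vectors \<open>e t\<close>.\<close>

definition inv_series :: "'a::field \<Rightarrow> 'a \<Rightarrow> 'a \<Rightarrow> nat \<Rightarrow> 'a fps" where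
  "inv_series Q g u r = gauss_series Q (u * g\<^sup>2 * Q ^ r) (inverse (g * Q ^ r))"

lemma omega_eq_defect_summand:
  "omega_eq_defect Q g u (fps_const C * fps_X ^ r * H) =
     fps_const C * fps_X ^ r *
       (fps_const (Q ^ r) * (1 - fps_const (- g) * fps_X) * ((1 - fps_const (u * g) * fps_X) * dilate Q H)
        - (1 - fps_X ^ 2) * H)"
proof -
  have "dilate Q (fps_const C * fps_X ^ r) = fps_const C * fps_const (Q ^ r) * fps_X ^ r"
    by (rule fps_ext) (simp add: dilate_nth)
  then show ?thesis
    by (simp add: omega_eq_defect_def dilate_mult algebra_simps del: fps_const_mult fps_const_mult_left fps_const_mult_right)
qed

lemma omega_eq_defect_add:
  "omega_eq_defect Q g u (f + h) = omega_eq_defect Q g u f + omega_eq_defect Q g u h"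
proof -
  have "dilate Q (f + h) = dilate Q f + dilate Q h"
    by (rule fps_ext) (simp add: dilate_nth distrib_left)
  then show ?thesis by (simp add: omega_eq_defect_def algebra_simps)
qed

text \<open>A telescoping certificate: the factor \<open>1 - Q^r\<close> makes it vanish at
  \<open>r = 0\<close>, and \<open>fps_X ^ r\<close> removes all orders below
  \<open>r\<close>.\<close>

definition certificate :: "'a::field \<Rightarrow> 'a \<Rightarrow> 'a \<Rightarrow> nat \<Rightarrow> 'a fps" where
  "certificate Q g u r = fps_const (inv_coeff Q g r * (1 - Q ^ r)) * fps_X ^ r *
     ((1 - fps_const (inverse (g * Q ^ r)) * fps_X) * inv_series Q g u r)"

lemma inv_series_defect:
  fixes Q :: "'a::field"
  assumes Q: "\<And>n. Q ^ Suc n \<noteq> 1" and "Q \<noteq> 0" "g \<noteq> 0"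
  shows "omega_eq_defect Q g u (fps_const (inv_coeff Q g r) * fps_X ^ r * inv_series Q g u r) =
    certificate Q g u (Suc r) - certificate Q g u r"
proof -
  define C H a where "C = inv_coeff Q g r" and "H = inv_series Q g u r" and "a = inverse (g * Q ^ r)"
  let ?l = "\<lambda>a::'a. 1 - fps_const a * fps_X"
  have wa: "u * g\<^sup>2 * Q ^ r * a = u * g"
    using assms by (simp add: a_def power2_eq_square field_simps)
  have H1: "?l (u * g) * dilate Q H = ?l a * H"
    using gauss_series_dilate[OF Q, of "u * g\<^sup>2 * Q ^ r" a] unfolding wa
    by (simp add: H_def inv_series_def a_def)
  \<comment> \<open>So \<open>H\<close> is also the bracket inside the certificate of index
    \<open>Suc r\<close>.\<close>
  have H2: "?l (inverse (g * Q ^ Suc r)) * inv_series Q g u (Suc r) = H"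
    using gauss_series_shift[OF Q \<open>Q \<noteq> 0\<close>, of a "u * g\<^sup>2 * Q ^ r"]
    by (simp add: H_def inv_series_def a_def divide_inverse ac_simps)
  have C1: "inv_coeff Q g (Suc r) * (1 - Q ^ Suc r) = C * (g * Q ^ r - a)"
  proof -
    have "inv_coeff Q g (Suc r) * (1 - Q ^ Suc r) = C * - ((1 - g\<^sup>2 * Q ^ (2 * r)) / (g * Q ^ r))"
      using Q[of r] by (simp add: inv_coeff_def C_def)
    also have "- ((1 - g\<^sup>2 * Q ^ (2 * r)) / (g * Q ^ r)) = g * Q ^ r - a"
      using assms by (simp add: a_def field_simps power2_eq_square flip: power_add mult_2)
    finally show ?thesis .
  qed
  \<comment> \<open>The quadratic terms cancel because \<open>a * (g * Q ^ r) = 1\<close>. What is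
    left splits into the parts belonging to the next and to the current certificate.\<close>
  have l: "fps_const (Q ^ r) * ?l (- g) * ?l a - (1 - fps_X ^ 2) =
      fps_const (g * Q ^ r - a) * fps_X - fps_const (1 - Q ^ r) * ?l a"
  proof -
    have ga: "a * (g * Q ^ r) = 1"
      using assms(2,3) by (simp add: a_def field_simps)
    then have "fps_const g * fps_const (Q ^ r) * fps_const a = 1"
      by (simp add: ac_simps)
    then have *: "fps_const g * (fps_const (Q ^ r) * (fps_const a * z)) = z" for z
      by (simp only: mult_1 flip: mult.assoc)
    show ?thesis
      by (simp add: * ga power2_eq_square algebra_simps
          del: fps_const_mult fps_const_add fps_const_sub
          flip: fps_const_neg fps_const_mult fps_const_sub)
  qed
  have "omega_eq_defect Q g u (fps_const C * fps_X ^ r * H) =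
      fps_const C * fps_X ^ r * ((fps_const (Q ^ r) * ?l (- g) * ?l a - (1 - fps_X ^ 2)) * H)"
    unfolding omega_eq_defect_summand H1 by (simp add: algebra_simps del: fps_const_mult)
  also have "\<dots> = fps_const C * fps_X ^ r * (fps_const (g * Q ^ r - a) * fps_X * H - fps_const (1 - Q ^ r) * (?l a * H))"
    unfolding l by (simp only: left_diff_distrib mult.assoc)
  also have "\<dots> = fps_const (C * (g * Q ^ r - a)) * fps_X ^ Suc r * H
      - fps_const (C * (1 - Q ^ r)) * fps_X ^ r * (?l a * H)"
    unfolding fps_const_mult[symmetric] by (simp only: right_diff_distrib power_Suc ac_simps)
  finally show ?thesis
    unfolding certificate_def C1 H2 by (simp add: C_def H_def a_def)
qed

text \<open>The defect of the sum up to \<open>n\<close> telescopes to the certificate of index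
  \<open>Suc n\<close>, which has no terms of order at most \<open>n\<close>. Hence the sum and the
  product form agree at order \<open>n\<close> by uniqueness.\<close>

theorem omega_series_expansion:
  fixes Q :: "'a::field"
  assumes Q: "\<And>n. Q ^ Suc n \<noteq> 1" and "Q \<noteq> 0" "g \<noteq> 0"
  shows "fps_nth (omega_series Q g u) n =
    (\<Sum>r\<le>n. inv_coeff Q g r *
       (inverse (g * Q ^ r) ^ (n - r) * gauss_coeff Q (u * g\<^sup>2 * Q ^ r) (n - r)))"
proof -
  define S where "S = (\<Sum>r\<le>n. fps_const (inv_coeff Q g r) * fps_X ^ r * inv_series Q g u r)"
  have defect: "omega_eq_defect Q g u (\<Sum>r\<le>R. fps_const (inv_coeff Q g r) * fps_X ^ r * inv_series Q g u r)
      = certificate Q g u (Suc R)" for R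
  proof (induction R)
    case 0
    show ?case using inv_series_defect[OF assms, of u 0] by (simp add: certificate_def)
  next
    case (Suc R)
    then show ?case
      by (simp only: sum.atMost_Suc omega_eq_defect_add inv_series_defect[OF assms]) simp
  qed
  have nth: "fps_nth S k = (\<Sum>r\<le>n. if k < r then 0 else inv_coeff Q g r *
       (inverse (g * Q ^ r) ^ (k - r) * gauss_coeff Q (u * g\<^sup>2 * Q ^ r) (k - r)))" for k
    unfolding S_def fps_sum_nth
    by (rule sum.cong) (simp_all add: mult.assoc fps_X_power_mult_nth inv_series_def gauss_series_def)
  have "fps_nth (omega_series Q g u) n = fps_nth S n"
  proof (rule omega_eq_defect_unique[OF Q])
    have "fps_nth S 0 = 1"
      unfolding nth by (subst sum.mono_neutral_right[of _ "{0}"]) (auto simp: inv_coeff_def)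
    then show "fps_nth (omega_series Q g u) 0 = fps_nth S 0"
      by (simp add: omega_series_def even_series_def gauss_series_def)
    show "fps_nth (omega_eq_defect Q g u (omega_series Q g u)) k = fps_nth (omega_eq_defect Q g u S) k"
      if "k \<le> n" for k
      unfolding S_def defect omega_series_defect[OF Q]
      using that by (auto simp add: certificate_def mult.assoc fps_X_power_mult_nth)
  qed simp
  also have "\<dots> = (\<Sum>r\<le>n. inv_coeff Q g r *
       (inverse (g * Q ^ r) ^ (n - r) * gauss_coeff Q (u * g\<^sup>2 * Q ^ r) (n - r)))"
    unfolding nth by (rule sum.cong) simp_all
  finally show ?thesis .
qed

section \<open>Quantum integers and the bar involution\<close>

lemma qv_power: "qv ^ k = Fraction_Field.Fract (monom 1 k) 1"
  by (induction k) (simp_all add: qv_def One_fract_def monom_Suc one_pCons monom_0)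

lemma qv_power_eq_1_iff [simp]: "qv ^ k = 1 \<longleftrightarrow> k = 0"
  by (auto simp: qv_power One_fract_def eq_fract monom_eq_1_iff)

lemma qv_powi_eq_1_iff [simp]: "qv powi k = 1 \<longleftrightarrow> k = 0"
  by (cases k rule: int_cases4) (simp_all add: power_int_minus inverse_eq_1_iff)

lemma qv_powi_eq_iff: "qv powi j = qv powi k \<longleftrightarrow> j = k"
  using qv_powi_eq_1_iff[of "j - k"] by (simp add: power_int_diff) metis

lemma qv_power_eq_powi_iff: "qv ^ t = qv powi k \<longleftrightarrow> int t = k"
  using qv_powi_eq_iff[of "int t" k] by simp

lemma qv_powi_add: "qv powi (j + k) = qv powi j * qv powi k"
  by (simp add: power_int_add)

lemma qv_powi_power: "(qv powi j) ^ k = qv powi (j * int k)"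
  by (simp add: power_int_power')

lemma qbar_uminus [simp]: "qbar (- x) = - qbar x"
  using qbar_simps(4)[of x "- x"] by (simp add: eq_neg_iff_add_eq_0 add.commute del: qbar_simps(4))

lemma qbar_diff [simp]: "qbar (x - y) = qbar x - qbar y"
  using qbar_simps(4)[of x "- y"] by (simp del: qbar_simps(4))

lemma qbar_inverse [simp]: "qbar (inverse x) = inverse (qbar x)"
proof (cases "x = 0")
  case False
  then have "qbar x * qbar (inverse x) = 1"
    by (simp flip: qbar_simps(5))
  then show ?thesis by (metis inverse_unique)
qed simp

lemma qbar_divide [simp]: "qbar (x / y) = qbar x / qbar y"
  by (simp add: divide_inverse)

lemma qbar_prod: "qbar (prod f A) = (\<Prod>x\<in>A. qbar (f x))"
  by (induction A rule: infinite_finite_induct) simp_all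

lemma qbar_power: "qbar (x ^ k) = qbar x ^ k"
  by (induction k) simp_all

lemma qbar_powi: "qbar (qv powi k) = qv powi (- k)"
  by (cases k rule: int_cases4) (simp_all add: power_int_minus qbar_power power_inverse)

lemma qint_0 [simp]: "qint t 0 = 0"
  by (simp add: qint_def)

lemma qint_eq_0_iff: "t > 0 \<Longrightarrow> qint t r = 0 \<longleftrightarrow> r = 0"
  by (auto simp: qint_def qv_powi_eq_iff qv_power_eq_powi_iff)

lemma qint_1 [simp]: "t > 0 \<Longrightarrow> qint t 1 = 1"
  by (simp add: qint_def qv_powi_eq_iff qv_power_eq_powi_iff)

lemma qbar_qint [simp]: "qbar (qint t r) = qint t r"
proof -
  have "qbar (qint t r) = - (qv powi (int t * r) - qv powi (- (int t * r))) / - (qv powi (int t) - qv powi (- int t))"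
    by (simp add: qint_def qbar_powi del: minus_divide_divide power_int_of_nat)
  then show ?thesis by (simp only: minus_divide_divide qint_def)
qed

lemma qfact_Suc: "qfact t (Suc r) = qfact t r * qint t (int (Suc r))"
  by (simp add: qfact_def)

lemma qfact_nonzero: "t > 0 \<Longrightarrow> qfact t r \<noteq> 0"
  by (simp add: qfact_def qint_eq_0_iff)

lemma qfact_0 [simp]: "qfact t 0 = 1"
  by (simp add: qfact_def)

lemma qbar_qfact [simp]: "qbar (qfact t r) = qfact t r"
  by (simp add: qfact_def qbar_prod)

lemma qint_alt:
  "qint t r = qv powi (int t * r) * (1 - qv powi (- 2 * (int t * r))) / (qv powi int t - qv powi (- int t))"
  by (simp add: qint_def right_diff_distrib mult.commute flip: qv_powi_add)

lemma qint_ratio: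
  assumes "t > 0"
  shows "qint t (N + 1 + int j) / qint t (int j + 1) =
    qv powi (int t * N) *
      ((1 - qv powi (- 2 * int t * (N + 1)) * (qv powi (- 2 * int t)) ^ j) / (1 - (qv powi (- 2 * int t)) ^ Suc j))"
proof -
  have d: "qv powi int t - qv powi (- int t) \<noteq> 0"
    using assms by (simp add: qv_power_eq_powi_iff)
  have "qv powi (int t * (N + 1 + int j)) = qv powi (int t * N) * qv powi (int t * (int j + 1))"
    unfolding qv_powi_add[symmetric] by (simp add: algebra_simps)
  moreover have "qv powi (- 2 * (int t * (N + 1 + int j))) =
      qv powi (- 2 * int t * (N + 1)) * (qv powi (- 2 * int t)) ^ j"
    unfolding qv_powi_power qv_powi_add[symmetric] by (simp add: algebra_simps)
  moreover have "qv powi (- 2 * (int t * (int j + 1))) = (qv powi (- 2 * int t)) ^ Suc j"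
    unfolding qv_powi_power by (simp add: algebra_simps)
  ultimately show ?thesis
    using d unfolding qint_alt by simp
qed

text \<open>The base is \<open>q^(-2t)\<close> rather than \<open>q^(2t)\<close> so that the
  Gaussian coefficient can be shown to lie in \<open>Z[q^-1]\<close>; the symmetrizing power of
  \<open>q\<close> stands in front.\<close>

lemma qbinom_eq_gauss_coeff:
  assumes "t > 0"
  shows "qbinom t (N + int s) s = qv powi (int t * int s * N) *
    gauss_coeff (qv powi (- 2 * int t)) (qv powi (- 2 * int t * (N + 1))) s"
proof -
  have "(\<Prod>j<s. qint t (N + int s - int j)) = (\<Prod>j<s. qint t (N + int s - int (s - Suc j)))"
    by (rule prod.nat_diff_reindex[symmetric])
  also have "\<dots> = (\<Prod>j<s. qint t (N + 1 + int j))"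
    by (rule prod.cong) (simp_all add: of_nat_diff algebra_simps)
  finally have 1: "(\<Prod>j<s. qint t (N + int s - int j)) = (\<Prod>j<s. qint t (N + 1 + int j))" .
  have 2: "qfact t s = (\<Prod>j<s. qint t (int j + 1))"
    by (induction s) (simp_all add: qfact_Suc add.commute)
  show ?thesis
    unfolding qbinom_def 1 2 gauss_coeff_def prod_dividef[symmetric] qint_ratio[OF assms] prod.distrib
    by (simp add: qv_powi_power ac_simps)
qed

lemma qbinom_0 [simp]: "qbinom t r 0 = 1"
  by (simp add: qbinom_def)

lemma qbinom_Suc_absorb:
  assumes "t > 0"
  shows "qint t (int (Suc k)) * qbinom t (r + 1) (Suc k) = qint t (r + 1) * qbinom t r k"
proof -
  have "(\<Prod>j<Suc k. qint t (r + 1 - int j)) = qint t (r + 1) * (\<Prod>j<k. qint t (r - int j))"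
    by (simp add: prod.lessThan_Suc_shift del: prod.lessThan_Suc)
  then show ?thesis
    using qfact_nonzero[OF assms, of k] qint_eq_0_iff[OF assms, of "int (Suc k)"]
    by (simp add: qbinom_def qfact_Suc field_simps)
qed

subsection \<open>Integrality\<close>

definition Zqinv :: "Qq set" where
  "Zqinv = {poly (map_poly of_int p) (inverse qv) | p :: int poly. True}"

lemma map_poly_of_int_add:
  "map_poly (of_int :: int \<Rightarrow> Qq) (p + r) = map_poly of_int p + map_poly of_int r"
  by (rule poly_eqI) (simp add: coeff_map_poly)

lemma map_poly_of_int_mult:
  "map_poly (of_int :: int \<Rightarrow> Qq) (p * r) = map_poly of_int p * map_poly of_int r"
proof (induction p)
  case (pCons a p)
  have "map_poly (of_int :: int \<Rightarrow> Qq) (smult a r) = smult (of_int a) (map_poly of_int r)"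
    by (rule poly_eqI) (simp add: coeff_map_poly)
  with pCons show ?case by (simp add: map_poly_pCons map_poly_of_int_add)
qed simp

lemma ZqinvI: "x = poly (map_poly of_int p) (inverse qv) \<Longrightarrow> x \<in> Zqinv"
  unfolding Zqinv_def by blast

lemma Zqinv_add: "x \<in> Zqinv \<Longrightarrow> y \<in> Zqinv \<Longrightarrow> x + y \<in> Zqinv"
  unfolding Zqinv_def by (auto simp flip: poly_add map_poly_of_int_add)

lemma Zqinv_mult: "x \<in> Zqinv \<Longrightarrow> y \<in> Zqinv \<Longrightarrow> x * y \<in> Zqinv"
  unfolding Zqinv_def by (auto simp flip: poly_mult map_poly_of_int_mult)

lemma Zqinv_0 [simp]: "0 \<in> Zqinv"
  by (rule ZqinvI[of _ 0]) simp

lemma Zqinv_1 [simp]: "1 \<in> Zqinv"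
  by (rule ZqinvI[of _ 1]) simp

lemma Zqinv_sum: "(\<And>x. x \<in> A \<Longrightarrow> f x \<in> Zqinv) \<Longrightarrow> sum f A \<in> Zqinv"
  by (induction A rule: infinite_finite_induct) (simp_all add: Zqinv_add)

lemma inverse_qv_power_Zqinv: "inverse qv ^ k \<in> Zqinv"
proof (rule ZqinvI)
  show "inverse qv ^ k = poly (map_poly of_int (monom 1 k)) (inverse qv)"
    by (simp add: map_poly_monom poly_monom)
qed

lemma qv_powi_Zqinv: "k \<le> 0 \<Longrightarrow> qv powi k \<in> Zqinv"
  using inverse_qv_power_Zqinv[of "nat (- k)"] by (simp add: power_int_def)

text \<open>Nested induction on \<open>n\<close> and \<open>s\<close> by the q-Pascal rule, starting
  from \<open>w = 1\<close>, where all coefficients but the first vanish.\<close>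

lemma gauss_coeff_Zqinv:
  assumes "k < 0"
  shows "gauss_coeff (qv powi k) ((qv powi k) ^ n) s \<in> Zqinv"
proof (induction n arbitrary: s)
  case 0
  then show ?case by (simp add: gauss_coeff_one)
next
  case (Suc n)
  show ?case
  proof (induction s)
    case (Suc s)
    have "(qv powi k) ^ Suc s \<noteq> 1"
      using assms unfolding qv_powi_power by simp
    then have "gauss_coeff (qv powi k) ((qv powi k) ^ Suc n) (Suc s) =
        gauss_coeff (qv powi k) ((qv powi k) ^ n) (Suc s) +
        (qv powi k) ^ n * gauss_coeff (qv powi k) ((qv powi k) ^ Suc n) s"
      using gauss_coeff_pascal[of "qv powi k" s "(qv powi k) ^ n"] by (simp add: mult.commute)
    moreover have "(qv powi k) ^ n \<in> Zqinv"
      unfolding qv_powi_power using assms by (intro qv_powi_Zqinv) (simp add: mult_nonpos_nonneg)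
    ultimately show ?case
      using \<open>\<And>s. gauss_coeff (qv powi k) ((qv powi k) ^ n) s \<in> Zqinv\<close> Suc
      by (simp add: Zqinv_add Zqinv_mult del: power_Suc)
  qed simp
qed

lemma qinvZ_eq: "qinvZ = {inverse qv * x | x. x \<in> Zqinv}"
  unfolding qinvZ_def Zqinv_def by blast

lemma qinvZ_0 [simp]: "0 \<in> qinvZ"
  unfolding qinvZ_eq using Zqinv_0 by fastforce

lemma qinvZ_diff: "x \<in> qinvZ \<Longrightarrow> y \<in> qinvZ \<Longrightarrow> x - y \<in> qinvZ"
proof -
  have "- 1 \<in> Zqinv" by (rule ZqinvI[of _ "[:-1:]"]) (simp add: map_poly_pCons)
  then have "a - b \<in> Zqinv" if "a \<in> Zqinv" "b \<in> Zqinv" for a b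
    using Zqinv_add[OF that(1) Zqinv_mult[OF _ that(2), of "- 1"]] by simp
  then show "x \<in> qinvZ \<Longrightarrow> y \<in> qinvZ \<Longrightarrow> x - y \<in> qinvZ"
    unfolding qinvZ_eq by (auto simp flip: right_diff_distrib)
qed

lemma qinvZ_powi_mult:
  assumes "k < 0" "x \<in> Zqinv"
  shows "qv powi k * x \<in> qinvZ"
proof -
  have "qv powi k = inverse qv * qv powi (k + 1)"
    by (simp add: power_int_add)
  moreover have "qv powi (k + 1) * x \<in> Zqinv"
    using assms by (simp add: Zqinv_mult qv_powi_Zqinv)
  ultimately show ?thesis unfolding qinvZ_eq by (auto simp: mult.assoc)
qed

lemma qsubst_pCons: "qsubst (pCons a p) = ratc a + inverse qv * qsubst p"
  by (simp add: qsubst_def map_poly_pCons)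

lemma qbar_qsubst: "qbar (qsubst p) = Fraction_Field.Fract p 1"
proof (induction p)
  case 0
  show ?case by (simp flip: Zero_fract_def)
next
  case (pCons a p)
  have "qbar (ratc a) = ratc a"
    by (simp add: ratc_def qbar_Fract qsubst_pCons)
  then have "qbar (qsubst (pCons a p)) = ratc a + qv * Fraction_Field.Fract p 1"
    by (simp add: qsubst_pCons pCons)
  also have "\<dots> = Fraction_Field.Fract (pCons a p) 1"
    by (simp add: ratc_def qv_def)
  finally show ?case .
qed

lemma Fract_reflect_poly: "Fraction_Field.Fract (reflect_poly p) 1 = qv ^ degree p * qsubst p"
proof -
  have "reflect_poly (map_poly ratc p) = map_poly ratc (reflect_poly p)"
    by (rule poly_eqI) (simp add: coeff_map_poly coeff_reflect_poly degree_map_poly)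
  then have "Fraction_Field.Fract (reflect_poly p) 1 = poly (reflect_poly (map_poly ratc p)) qv"
    by (simp add: poly_map_poly_ratc_qv)
  also have "\<dots> = qv ^ degree p * qsubst p"
    by (simp add: poly_reflect_poly_nz qsubst_def degree_map_poly)
  finally show ?thesis .
qed

lemma ratc_of_int: "ratc (of_int k) = of_int k"
proof -
  have nat: "ratc (of_nat j) = of_nat j" for j
    by (induction j) simp_all
  have "ratc (- a) = - ratc a" for a
    using ratc_simps(3)[of a "- a"] by (simp add: eq_neg_iff_add_eq_0 add.commute del: ratc_simps(3))
  then show ?thesis
    by (cases k rule: int_cases2) (simp_all add: nat)
qed

text \<open>Write \<open>x = P(q^-1)\<close>; invariance gives \<open>P(q^-1) = P(q)\<close>.
  Multiplied by \<open>q^(deg P)\<close>, this equates the reflected polynomial, of degree at most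
  \<open>deg P\<close>, with one of degree \<open>2 deg P\<close>. So \<open>P\<close> is constant,
  and its constant term is zero.\<close>

lemma qinvZ_qbar_fixed:
  assumes "x \<in> qinvZ" "qbar x = x"
  shows "x = 0"
proof (rule ccontr)
  assume "x \<noteq> 0"
  obtain p :: "int poly" where p: "x = inverse qv * poly (map_poly of_int p) (inverse qv)"
    using assms(1) unfolding qinvZ_def by blast
  define P where "P = pCons 0 (map_poly rat_of_int p)"
  have "map_poly ratc (map_poly of_int p) = map_poly of_int p"
    by (rule poly_eqI) (simp add: coeff_map_poly ratc_of_int)
  then have x: "x = qsubst P"
    by (simp add: P_def p qsubst_pCons) (simp add: qsubst_def)
  then have "P \<noteq> 0" using \<open>x \<noteq> 0\<close> by auto
  have "Fraction_Field.Fract (reflect_poly P) 1 = Fraction_Field.Fract (monom 1 (degree P) * P) 1"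
  proof -
    have "Fraction_Field.Fract (monom 1 (degree P) * P) 1 = qv ^ degree P * Fraction_Field.Fract P 1"
      by (simp add: qv_power)
    moreover have "Fraction_Field.Fract P 1 = qsubst P"
      using assms(2) by (simp add: x qbar_qsubst)
    ultimately show ?thesis
      by (simp add: Fract_reflect_poly)
  qed
  then have "reflect_poly P = monom 1 (degree P) * P"
    by (simp add: eq_fract)
  moreover have "degree (monom 1 (degree P) * P) = 2 * degree P"
    using \<open>P \<noteq> 0\<close> by (simp add: degree_mult_eq degree_monom_eq)
  ultimately have "degree P = 0"
    using degree_reflect_poly_le[of P] by simp
  then show False
    using \<open>P \<noteq> 0\<close> by (auto simp: P_def split: if_splits)
qed

subsection \<open>The coefficient formula as a power series coefficient\<close>

lemma sum_even_index:
  fixes f :: "nat \<Rightarrow> 'a::comm_monoid_add"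
  assumes "\<And>i. odd i \<Longrightarrow> f i = 0"
  shows "(\<Sum>i=0..n. f i) = (\<Sum>x=0..n div 2. f (2 * x))"
proof -
  have "(\<Sum>x=0..n div 2. f (2 * x)) = sum f ((*) 2 ` {0..n div 2})"
    by (subst sum.reindex) (auto simp: inj_on_def)
  also have "\<dots> = sum f {0..n}"
  proof (rule sum.mono_neutral_left)
    show "\<forall>i\<in>{0..n} - (*) 2 ` {0..n div 2}. f i = 0"
    proof
      fix i assume i: "i \<in> {0..n} - (*) 2 ` {0..n div 2}"
      then have "odd i" by (auto elim!: evenE)
      then show "f i = 0" by (rule assms)
    qed
  qed auto
  finally show ?thesis ..
qed

abbreviation Qd :: Qq where "Qd \<equiv> qv powi (- 2)"

lemma Qd_power: "Qd ^ k = qv powi (- 2 * int k)"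
  unfolding qv_powi_power ..

lemma Qd_not_root: "Qd ^ Suc n \<noteq> 1"
  unfolding Qd_power by simp

text \<open>The coefficient of \<open>e t\<close>. It sees the weights only through
  \<open>\<gamma>\<close> and \<open>N\<close>, which explains why coefficients for different
  \<open>c\<close> coincide.\<close>

definition omega_coeff :: "int \<Rightarrow> int \<Rightarrow> nat \<Rightarrow> Qq" where
  "omega_coeff \<gamma> N t = qv powi (- (int t * (int t + 1) div 2)) *
     fps_nth (omega_series Qd (qv powi (- 2 * \<gamma>)) (qv powi (- 2 * (N + 1)))) t"

lemma omega_series_nth:
  "fps_nth (omega_series Q g u) t =
    (\<Sum>x = 0..t div 2. gauss_coeff (Q\<^sup>2) (g\<^sup>2) x * (g ^ (t - 2 * x) * gauss_coeff Q u (t - 2 * x)))"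
  unfolding omega_series_def fps_mult_nth
  by (subst sum_even_index) (simp_all add: even_series_def gauss_series_def)

text \<open>Term by term with \<open>t = s + 2 * x\<close>: both q-binomials become Gaussian
  coefficients, and the rest compares exponents of \<open>q\<close>. The \<open>n\<close> here will
  be the shifted \<open>n - \<sigma> Two\<close>.\<close>

lemma Omega_formula_eq:
  assumes "n - int b + int t = N" "m = N + 2 * \<gamma> + int t"
  shows "Omega_formula \<gamma> m n b t = omega_coeff \<gamma> N t"
  unfolding Omega_formula_def omega_coeff_def omega_series_nth sum_distrib_left
proof (rule sum.cong)
  fix x assume "x \<in> {0..t div 2}"
  then obtain s where t: "t = s + 2 * x"
    by (metis atLeastAtMost_iff le_add_diff_inverse2 less_eq_div_iff_mult_less_eq mult.commute zero_less_numeral)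
  have 1: "qbinom 2 (\<gamma> + int x - 1) x = qv powi (2 * int x * (\<gamma> - 1)) *
      gauss_coeff (Qd\<^sup>2) ((qv powi (- 2 * \<gamma>))\<^sup>2) x"
    using qbinom_eq_gauss_coeff[of 2 "\<gamma> - 1" x] unfolding qv_powi_power
    by (simp add: algebra_simps)
  have top: "n - int b + 2 * int t - 2 * int x = N + int s"
    using assms t by simp
  have 2: "qbinom 1 (n - int b + 2 * int t - 2 * int x) (t - 2 * x) =
      qv powi (int s * N) * gauss_coeff Qd (qv powi (- 2 * (N + 1))) s"
    unfolding top using qbinom_eq_gauss_coeff[of 1 N s] t by simp
  \<comment> \<open>All but \<open>s (s + 1)\<close> is visibly even, so only this triangular number
    keeps a \<open>div\<close>; it recurs in \<open>e2\<close> and cancels.\<close>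
  have e1: "(int t - 2 * int x) * (int t - 1 - 2 * m) div 2 =
      - (int s * (int s + 1) div 2) - int s * int x - int s * (N + 2 * \<gamma>)"
  proof -
    have "(int t - 2 * int x) * (int t - 1 - 2 * m) =
        - (int s * (int s + 1)) + 2 * (- int s * int x - int s * (N + 2 * \<gamma>))"
      using assms t by (simp add: algebra_simps)
    moreover have "even (int s * (int s + 1))" by simp
    ultimately show ?thesis by (elim evenE) simp
  qed
  have e2: "int t * (int t + 1) div 2 = int s * (int s + 1) div 2 + 2 * int s * int x + 2 * int x * int x + int x"
  proof -
    have "int t * (int t + 1) = int s * (int s + 1) + 2 * (2 * int s * int x + 2 * int x * int x + int x)"
      using t by (simp add: algebra_simps)
    moreover have "even (int s * (int s + 1))" by simp
    ultimately show ?thesis by (elim evenE) simp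
  qed
  have g: "(qv powi (- 2 * \<gamma>)) ^ (t - 2 * x) = qv powi (- 2 * \<gamma> * int s)"
    unfolding qv_powi_power using t by simp
  have q: "qv powi (2 * int x * (\<gamma> - 1)) * qv powi (int s * N) *
      qv powi (- (int s * (int s + 1) div 2) - int s * int x - int s * (N + 2 * \<gamma>)) *
      qv powi (int x * (- m + n - int b + int t + 1)) =
      qv powi (- (int t * (int t + 1) div 2)) * qv powi (- 2 * \<gamma> * int s)"
  proof -
    have m: "- m + n - int b + int t + 1 = 1 - 2 * \<gamma> - int s - 2 * int x"
      using assms t by simp
    show ?thesis
      unfolding e2 m qv_powi_add[symmetric] by (rule arg_cong[where f = "power_int qv"]) (simp add: algebra_simps)
  qed
  show "qbinom 2 (\<gamma> + int x - 1) x * qbinom 1 (n - int b + 2 * int t - 2 * int x) (t - 2 * x) *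
      qv powi ((int t - 2 * int x) * (int t - 1 - 2 * m) div 2) *
      qv powi (int x * (- m + n - int b + int t + 1)) =
      qv powi (- (int t * (int t + 1) div 2)) *
      (gauss_coeff (Qd\<^sup>2) ((qv powi (- 2 * \<gamma>))\<^sup>2) x *
       ((qv powi (- 2 * \<gamma>)) ^ (t - 2 * x) * gauss_coeff Qd (qv powi (- 2 * (N + 1))) (t - 2 * x)))"
    unfolding 1 2 e1 g
    using arg_cong[OF q, of "\<lambda>z. z * gauss_coeff (Qd\<^sup>2) ((qv powi (- 2 * \<gamma>))\<^sup>2) x * gauss_coeff Qd (qv powi (- 2 * (N + 1))) s"] t
    by (simp add: ac_simps)
qed simp

text \<open>For \<open>t > 0\<close> the leading power of \<open>q\<close> is negative, and both
  Gaussian coefficients have parameters with exponents \<open>\<gamma>\<close> and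
  \<open>N + 1\<close> in the naturals. The bound is \<open>-1\<close> since
  \<open>\<sigma> Two\<close> may lower \<open>N\<close> by one.\<close>

lemma omega_coeff_qinvZ:
  assumes "\<gamma> > 0" "N \<ge> - 1" "t > 0"
  shows "omega_coeff \<gamma> N t \<in> qinvZ"
  unfolding omega_coeff_def
proof (rule qinvZ_powi_mult)
  have "int t * (int t + 1) \<ge> 1 * 2"
    using assms(3) by (intro mult_mono) auto
  then show "- (int t * (int t + 1) div 2) < 0"
    by presburger
  have "gauss_coeff (Qd\<^sup>2) ((qv powi (- 2 * \<gamma>))\<^sup>2) x \<in> Zqinv" for x
    using gauss_coeff_Zqinv[of "- 4" "nat \<gamma>" x] assms(1) unfolding qv_powi_power by simp
  moreover have "gauss_coeff Qd (qv powi (- 2 * (N + 1))) s \<in> Zqinv" for s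
    using gauss_coeff_Zqinv[of "- 2" "nat (N + 1)" s] assms(2) unfolding qv_powi_power by simp
  moreover have "(qv powi (- 2 * \<gamma>)) ^ s \<in> Zqinv" for s
    unfolding qv_powi_power using assms(1) by (intro qv_powi_Zqinv) (simp add: mult_nonneg_nonneg)
  ultimately show "fps_nth (omega_series Qd (qv powi (- 2 * \<gamma>)) (qv powi (- 2 * (N + 1)))) t \<in> Zqinv"
    unfolding omega_series_nth by (intro Zqinv_sum Zqinv_mult)
qed

lemma omega_coeff_0 [simp]: "omega_coeff \<gamma> N 0 = 1"
  by (simp add: omega_coeff_def omega_series_nth)

text \<open>These are the coordinates of the icanonical basis element with respect to the invariant
  vectors \<open>B\<^sub>2\<^bsup>(b-r)\<^esup> B\<^sub>1\<^bsup>(c-r)\<^esup> \<eta>\<close>.\<close>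

definition binv_coeff :: "int \<Rightarrow> nat \<Rightarrow> Qq" where
  "binv_coeff \<gamma> r = (\<Prod>i<r. - (qint 1 (2 * \<gamma> + 2 * int i) / qint 1 (int i + 1)))"

lemma qbar_binv_coeff [simp]: "qbar (binv_coeff \<gamma> r) = binv_coeff \<gamma> r"
  by (simp add: binv_coeff_def qbar_prod)

text \<open>For \<open>N = n - b + c - \<sigma> Two\<close> and \<open>M = m - c\<close> this is the
  coordinate of the k-th vector in the invariant vector for \<open>b\<close> and
  \<open>c\<close>.\<close>

definition fcoeff :: "int \<Rightarrow> nat \<Rightarrow> nat \<Rightarrow> Qq" where
  "fcoeff N M k = qv powi (- (int k * N) - int k * (int k + 1) div 2) * qbinom 1 (int M + int k) k"

lemma triangular_add:
  "(int r + int k) * (int r + int k + 1) div 2 =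
    int r * (int r + 1) div 2 + int k * (int k + 1) div 2 + int r * int k"
proof -
  have "(int r + int k) * (int r + int k + 1) =
      int r * (int r + 1) + int k * (int k + 1) + 2 * (int r * int k)"
    by (simp add: algebra_simps)
  moreover have "even (int r * (int r + 1))" "even (int k * (int k + 1))" by simp_all
  ultimately show ?thesis by (elim evenE) simp
qed

text \<open>The factor of index \<open>i\<close> contributes \<open>q^(-(i + 1))\<close>, and these
  exponents add up to a triangular number.\<close>

lemma binv_coeff_eq:
  "binv_coeff \<gamma> r = qv powi (- (int r * (int r + 1) div 2)) * inv_coeff Qd (qv powi (- 2 * \<gamma>)) r"
proof (induction r)
  case (Suc r)
  let ?g = "qv powi (- 2 * \<gamma>)"
  have gQ: "inverse (?g * Qd ^ r) = qv powi (2 * \<gamma> + 2 * int r)"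
    unfolding Qd_power qv_powi_add[symmetric] power_int_minus[symmetric] by (simp add: add.commute)
  have num: "?g\<^sup>2 * Qd ^ (2 * r) = qv powi (- 2 * (2 * \<gamma> + int r)) * Qd ^ r"
    unfolding qv_powi_power qv_powi_add[symmetric] by (simp add: algebra_simps)
  have "qint 1 (2 * \<gamma> + 2 * int r) / qint 1 (int r + 1) =
      qv powi (2 * \<gamma> + 2 * int r - 1 - int r) * ((1 - ?g\<^sup>2 * Qd ^ (2 * r)) / (1 - Qd ^ Suc r))"
    using qint_ratio[of 1 "2 * \<gamma> + int r - 1" r] unfolding num
    by (simp add: algebra_simps)
  also have "qv powi (2 * \<gamma> + 2 * int r - 1 - int r) = qv powi (- int (Suc r)) * inverse (?g * Qd ^ r)"
    unfolding gQ qv_powi_add[symmetric] by simp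
  finally have "- (qint 1 (2 * \<gamma> + 2 * int r) / qint 1 (int r + 1)) = qv powi (- int (Suc r)) *
      - ((1 - ?g\<^sup>2 * Qd ^ (2 * r)) / (?g * Qd ^ r * (1 - Qd ^ Suc r)))"
    by (simp add: divide_inverse ac_simps)
  moreover have "qv powi (- (int (Suc r) * (int (Suc r) + 1) div 2)) =
      qv powi (- (int r * (int r + 1) div 2)) * qv powi (- int (Suc r))"
    using triangular_add[of r 1] unfolding qv_powi_add[symmetric] by (simp add: algebra_simps)
  ultimately show ?case
    using Suc.IH by (simp add: binv_coeff_def inv_coeff_def ac_simps del: power_Suc of_nat_Suc)
qed (simp add: binv_coeff_def inv_coeff_def)

text \<open>The q-series identity at \<open>Q = q^-2\<close>, \<open>g = Q^\<gamma>\<close>,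
  \<open>u = Q^(N+1)\<close>. The hypothesis on \<open>M\<close> turns \<open>u g^2 Q^r\<close> into
  \<open>Q^(M+r+1)\<close>, the parameter of the q-binomial in \<open>fcoeff\<close>.\<close>

lemma omega_coeff_expansion:
  assumes "int M = N + 2 * \<gamma>"
  shows "omega_coeff \<gamma> N t = (\<Sum>r\<le>t. binv_coeff \<gamma> r * fcoeff N (M + r) (t - r))"
proof -
  let ?g = "qv powi (- 2 * \<gamma>)" and ?u = "qv powi (- 2 * (N + 1))"
  have "omega_coeff \<gamma> N t = (\<Sum>r\<le>t. qv powi (- (int t * (int t + 1) div 2)) * (inv_coeff Qd ?g r *
       (inverse (?g * Qd ^ r) ^ (t - r) * gauss_coeff Qd (?u * ?g\<^sup>2 * Qd ^ r) (t - r))))"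
    unfolding omega_coeff_def sum_distrib_left[symmetric]
    by (subst omega_series_expansion[OF Qd_not_root]) simp_all
  also have "\<dots> = (\<Sum>r\<le>t. binv_coeff \<gamma> r * fcoeff N (M + r) (t - r))"
  proof (rule sum.cong)
    fix r assume "r \<in> {..t}"
    then obtain k where t: "t = r + k" by (auto simp: le_iff_add)
    have w: "?u * ?g\<^sup>2 * Qd ^ r = qv powi (- 2 * (int (M + r) + 1))"
      unfolding qv_powi_power qv_powi_add[symmetric] using assms by (simp add: algebra_simps)
    have a: "inverse (?g * Qd ^ r) ^ k = qv powi ((2 * \<gamma> + 2 * int r) * int k)"
      unfolding Qd_power qv_powi_add[symmetric] power_int_minus[symmetric] qv_powi_power by (simp add: add.commute)
    have e: "qv powi (- (int t * (int t + 1) div 2)) * qv powi ((2 * \<gamma> + 2 * int r) * int k) =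
        qv powi (- (int r * (int r + 1) div 2)) *
        (qv powi (- (int k * N) - int k * (int k + 1) div 2) * qv powi (int k * int (M + r)))"
      using triangular_add[of r k] assms t unfolding qv_powi_add[symmetric]
      by (intro arg_cong[where f = "power_int qv"]) (simp add: algebra_simps)
    have b: "qbinom 1 (int (M + r) + int k) k =
        qv powi (int k * int (M + r)) * gauss_coeff Qd (qv powi (- 2 * (int (M + r) + 1))) k"
      using qbinom_eq_gauss_coeff[of 1 "int (M + r)" k] by simp
    have tk: "t - r = k" using t by simp
    show "qv powi (- (int t * (int t + 1) div 2)) * (inv_coeff Qd ?g r *
       (inverse (?g * Qd ^ r) ^ (t - r) * gauss_coeff Qd (?u * ?g\<^sup>2 * Qd ^ r) (t - r))) =
       binv_coeff \<gamma> r * fcoeff N (M + r) (t - r)"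
      unfolding tk w a binv_coeff_eq fcoeff_def b
      using arg_cong[OF e, of "\<lambda>z. z * inv_coeff Qd ?g r * gauss_coeff Qd (qv powi (- 2 * (int (M + r) + 1))) k"]
      by (simp only: ac_simps)
  qed simp
  finally show ?thesis .
qed

section \<open>The action of the Chevalley generators\<close>

lemma urels_uideal: "r \<in> urels \<Longrightarrow> r \<in> uideal"
  using uideal.step[OF uideal.zero, of r 1 1] by simp

lemma ucong_refl: "ucong x x"
  by (simp add: ucong_def uideal.zero)

lemma fscal_commute: "x * fscal a = fscal a * x"
  by (induction x rule: freealg_induct)
    (simp_all add: fscal_def distrib_left distrib_right mult_single mult.commute)

lemma mult_uscale_one: "x * uscale a 1 = uscale a x"
  by transfer (simp add: fscal_commute ucong_refl)

lemma Kinv_KK: "Kinv i * KK i = 1"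
  by transfer (simp add: ucong_def urels_uideal urels.inv_K)

lemma KK_FF_Kinv: "KK i * FF j * Kinv i = uscale (qv powi (- cartan i j)) (FF j)"
  by transfer (simp only: ucong_def urels_uideal urels.K_F)

lemma EE_FF_commutator:
  assumes a: "a = (if i = j then 1 / (qv - inverse qv) else 0)"
  shows "EE i * FF j - FF j * EE i = uscale a (KK i - Kinv i)"
proof (transfer fixing: i j a)
  have "fE i * fF j - fF j * fE i - fscal a * (fK i - fKinv i) \<in> urels"
    using urels.E_F[of i j] by (auto simp: a fscal_def)
  then show "ucong (fE i * fF j - fF j * fE i) (fscal a * (fK i - fKinv i))"
    unfolding ucong_def by (rule urels_uideal)
qed

context U_module
begin

text \<open>Scaling a vector is acting by the central element \<open>uscale a 1\<close>.\<close>

lemma act_scale: "act x (scale a v) = scale a (act x v)"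
  by (metis act_one act_mult act_uscale mult_uscale_one)

lemma act_zero_right [simp]: "act x 0 = 0"
  using act_add_right[of x 0 0] by simp

lemma act_minus_right: "act x (- v) = - act x v"
  using act_scale[of x "- 1" v] by simp

lemma act_zero_left [simp]: "act 0 v = 0"
  using act_add_left[of 0 0 v] by simp

lemma act_diff_left: "act (x - y) v = act x v - act y v"
  using act_add_left[of "x - y" y v] by (simp add: eq_diff_eq)

lemma act_sum: "act x (sum f A) = (\<Sum>a\<in>A. act x (f a))"
  by (induction A rule: infinite_finite_induct) (simp_all add: act_add_right)

lemma act_power: "act (x ^ k) v = (act x ^^ k) v"
  by (induction k) (simp_all add: act_one act_mult)

lemma funpow_act_scale: "(act x ^^ k) (scale a v) = scale a ((act x ^^ k) v)"
  by (induction k) (simp_all add: act_scale)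

lemma act_divpow: "act (divpow x (int k)) v = scale (1 / qfact 1 k) ((act x ^^ k) v)"
  by (simp add: divpow_def act_uscale act_power)

lemma act_divpow_neg: "k < 0 \<Longrightarrow> act (divpow x k) v = 0"
  by (simp add: divpow_def)

lemma Kinv_weight:
  assumes "act (KK i) v = scale (qv powi a) v"
  shows "act (Kinv i) v = scale (qv powi (- a)) v"
proof -
  have "v = scale (qv powi a) (act (Kinv i) v)"
    by (metis Kinv_KK act_mult act_one act_scale assms)
  then have "scale (qv powi (- a)) v = scale (qv powi (- a)) (scale (qv powi a) (act (Kinv i) v))"
    by simp
  then show ?thesis
    by (simp flip: qv_powi_add)
qed

lemma KK_FF: "act (KK i) (act (FF j) v) = scale (qv powi (- cartan i j)) (act (FF j) (act (KK i) v))"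
proof -
  have "act (KK i) (act (FF j) v) = act (KK i * FF j * Kinv i) (act (KK i) v)"
    by (metis Kinv_KK act_mult act_one)
  then show ?thesis
    by (simp add: KK_FF_Kinv act_uscale)
qed

lemma KK_FF_funpow:
  assumes "act (KK i) v = scale (qv powi a) v"
  shows "act (KK i) ((act (FF j) ^^ k) v) = scale (qv powi (a - int k * cartan i j)) ((act (FF j) ^^ k) v)"
proof (induction k)
  case (Suc k)
  then show ?case
    by (simp add: KK_FF act_scale algebra_simps flip: qv_powi_add)
qed (simp add: assms)

lemma EE_FF:
  "act (EE i) (act (FF j) v) = act (FF j) (act (EE i) v) +
    scale (if i = j then 1 / (qv - inverse qv) else 0) (act (KK i) v - act (Kinv i) v)"
proof -
  have "act (EE i * FF j - FF j * EE i) v =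
      scale (if i = j then 1 / (qv - inverse qv) else 0) (act (KK i) v - act (Kinv i) v)"
    unfolding EE_FF_commutator[OF refl] act_uscale act_diff_left ..
  then show ?thesis
    by (simp only: act_diff_left act_mult diff_eq_eq add.commute)
qed

lemma EE_FF_funpow_other:
  "i \<noteq> j \<Longrightarrow> act (EE i) ((act (FF j) ^^ k) v) = (act (FF j) ^^ k) (act (EE i) v)"
  by (induction k) (simp_all add: EE_FF)

end

section \<open>Strings for one simple root, and independence by weights\<close>

lemma qv_diff_inverse_nonzero: "qv - inverse qv \<noteq> 0"
  using qv_powi_eq_iff[of 1 "- 1"] by (simp add: power_int_minus)

lemma qint_one_eq:
  "qint 1 r = (qv powi r - qv powi (- r)) / (qv - inverse qv)"
  "qint (Suc 0) r = (qv powi r - qv powi (- r)) / (qv - inverse qv)"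
  by (simp_all add: qint_def power_int_minus)

lemma qint_mult:
  "(qint 1 a * (qv - inverse qv)) * (qint 1 b * (qv - inverse qv)) =
    qv powi (a + b) - qv powi (a - b) - qv powi (b - a) + qv powi (- a - b)"
proof -
  have d: "qint 1 r * (qv - inverse qv) = qv powi r - qv powi (- r)" for r
    using qv_diff_inverse_nonzero by (simp only: qint_one_eq) simp
  show ?thesis
    unfolding d by (simp add: algebra_simps flip: qv_powi_add)
qed

text \<open>The induction step of the string formula \<open>EE_FF_string\<close>.\<close>

lemma qint_string_identity:
  "qint 1 k * qint 1 (l - k + 1) + qint 1 (l - 2 * k) = qint 1 (k + 1) * qint 1 (l - k)"
proof -
  let ?d = "qv - inverse qv"
  have dist: "(a * b + c * e) * (d * d) = (a * d) * (b * d) + (c * d) * (e * d)" for a b c d e :: Qq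
    by (simp add: algebra_simps)
  \<comment> \<open>The factor \<open>qint 1 1\<close> equals 1 and gives the single term the
    product shape that \<open>qint_mult\<close> expects.\<close>
  have "(qint 1 k * qint 1 (l - k + 1) + qint 1 (l - 2 * k) * qint 1 1) * (?d * ?d) =
      (qint 1 k * ?d) * (qint 1 (l - k + 1) * ?d) + (qint 1 (l - 2 * k) * ?d) * (qint 1 1 * ?d)"
    by (rule dist)
  also have "\<dots> = (qint 1 (k + 1) * ?d) * (qint 1 (l - k) * ?d)"
    unfolding qint_mult by (simp add: algebra_simps)
  also have "\<dots> = (qint 1 (k + 1) * qint 1 (l - k)) * (?d * ?d)"
    by (simp only: ac_simps)
  finally show ?thesis
    using qv_diff_inverse_nonzero qint_1[of 1] by (simp only: mult_cancel_right mult_eq_0_iff mult_1_right) simp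
qed

lemma qint_split:
  "qint 1 a * qv powi k = qint 1 (a - k) + qv powi a * qint 1 k"
  unfolding qint_one_eq times_divide_eq_left times_divide_eq_right add_divide_distrib[symmetric]
  by (rule arg_cong[where f = "\<lambda>z. z / (qv - inverse qv)"])
    (simp add: algebra_simps flip: qv_powi_add)

context U_module
begin

lemma EE_FF_string:
  assumes "act (EE i) u = 0" "act (KK i) u = scale (qv powi l) u"
  shows "act (EE i) ((act (FF i) ^^ Suc k) u) =
    scale (qint 1 (int k + 1) * qint 1 (l - int k)) ((act (FF i) ^^ k) u)"
proof (induction k)
  case 0
  show ?case
    using assms Kinv_weight[OF assms(2)]
    by (simp add: EE_FF qint_one_eq flip: scale_left_diff_distrib)
next
  case (Suc k)
  let ?w = "(act (FF i) ^^ Suc k) u"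
  have K: "act (KK i) ?w = scale (qv powi (l - 2 * int (Suc k))) ?w"
    using KK_FF_funpow[OF assms(2), where j = i and k = "Suc k"] by (simp add: cartan_def algebra_simps)
  have "act (EE i) ((act (FF i) ^^ Suc (Suc k)) u) = act (FF i) (act (EE i) ?w) +
      scale (1 / (qv - inverse qv)) (act (KK i) ?w - act (Kinv i) ?w)"
    by (simp add: EE_FF)
  also have "act (KK i) ?w - act (Kinv i) ?w =
      scale (qv powi (l - 2 * int (Suc k)) - qv powi (- (l - 2 * int (Suc k)))) ?w"
    unfolding K Kinv_weight[OF K] by (simp only: scale_left_diff_distrib)
  also have "act (FF i) (act (EE i) ?w) = scale (qint 1 (int k + 1) * qint 1 (l - int k)) ?w"
    unfolding Suc.IH by (simp add: act_scale)
  also have "scale (1 / (qv - inverse qv))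
      (scale (qv powi (l - 2 * int (Suc k)) - qv powi (- (l - 2 * int (Suc k)))) ?w) =
      scale (qint 1 (l - 2 * int (Suc k))) ?w"
    unfolding qint_one_eq by simp
  finally have "act (EE i) ((act (FF i) ^^ Suc (Suc k)) u) =
      scale (qint 1 (int k + 1) * qint 1 (l - int k) + qint 1 (l - 2 * int (Suc k))) ?w"
    by (simp only: scale_left_distrib)
  moreover have "qint 1 (int k + 1) * qint 1 (l - int k) + qint 1 (l - 2 * int (Suc k)) =
      qint 1 (int (Suc k) + 1) * qint 1 (l - int (Suc k))"
    using qint_string_identity[of "int (Suc k)" l] by (simp add: algebra_simps)
  ultimately show ?case by simp
qed

text \<open>Applying \<open>EE i\<close> to the next vector returns the previous one times
  \<open>[k + 1] [l - k]\<close>, which is nonzero for \<open>k < l\<close>.\<close>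

lemma FF_string_nonzero:
  assumes "act (EE i) u = 0" "act (KK i) u = scale (qv powi (int l)) u" "u \<noteq> 0" "k \<le> l"
  shows "(act (FF i) ^^ k) u \<noteq> 0"
  using \<open>k \<le> l\<close>
proof (induction k)
  case (Suc k)
  have "act (EE i) ((act (FF i) ^^ Suc k) u) \<noteq> 0"
    unfolding EE_FF_string[OF assms(1,2)] using Suc by (simp add: qint_eq_0_iff)
  then show ?case by force
qed (simp add: assms)

text \<open>Applying \<open>KK i\<close> to a relation and subtracting one eigenvalue times it
  removes that eigenvector and rescales the others by nonzero factors.\<close>

lemma independent_weight_vectors:
  assumes "finite A" "inj_on wt A"
    and wt: "\<And>a. a \<in> A \<Longrightarrow> act (KK i) (x a) = scale (qv powi (wt a)) (x a)"
    and nz: "\<And>a. a \<in> A \<Longrightarrow> x a \<noteq> 0"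
  shows "inj_on x A" "independent (x ` A)"
proof -
  show inj: "inj_on x A"
  proof (rule inj_onI)
    fix a b assume ab: "a \<in> A" "b \<in> A" "x a = x b"
    then have "scale (qv powi wt a) (x a) = scale (qv powi wt b) (x a)"
      using wt by metis
    then have "wt a = wt b"
      using nz ab by (simp add: qv_powi_eq_iff del: power_int_of_nat)
    then show "a = b" using ab assms(2) by (simp add: inj_on_def)
  qed
  have zero: "\<forall>a\<in>A. u a = 0" if "(\<Sum>a\<in>A. scale (u a) (x a)) = 0" for u
    using assms(1,2) wt nz that
  proof (induction A arbitrary: u rule: finite_induct)
    case (insert c A)
    define S where "S = (\<Sum>a\<in>A. scale (u a) (x a))"
    have S: "scale (u c) (x c) + S = 0"
      using insert by (simp add: S_def)
    have "(\<Sum>a\<in>A. scale (u a * (qv powi wt a - qv powi wt c)) (x a)) =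
        act (KK i) S - scale (qv powi wt c) S"
      unfolding S_def act_sum scale_sum_right sum_subtractf[symmetric]
    proof (rule sum.cong)
      fix a assume "a \<in> A"
      then show "scale (u a * (qv powi wt a - qv powi wt c)) (x a) =
          act (KK i) (scale (u a) (x a)) - scale (qv powi wt c) (scale (u a) (x a))"
        using insert.prems(2)[of a] by (simp add: act_scale mult.commute flip: scale_left_diff_distrib right_diff_distrib)
    qed simp
    also have "\<dots> = 0"
    proof -
      have "S = scale (- u c) (x c)"
        using S by (simp add: add_eq_0_iff)
      then show ?thesis
        using insert.prems(2)[of c] by (simp add: act_scale act_minus_right mult.commute)
    qed
    finally have "\<forall>a\<in>A. u a * (qv powi wt a - qv powi wt c) = 0"
      using insert.prems by (intro insert.IH) auto
    moreover have "qv powi wt a \<noteq> qv powi wt c" if "a \<in> A" for a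
      using insert.prems(1) insert.hyps(2) that by (auto simp: qv_powi_eq_iff dest: sym)
    ultimately have A: "\<forall>a\<in>A. u a = 0" by auto
    then have "S = 0" by (simp add: S_def)
    with S have "u c = 0" using insert.prems(3)[of c] by simp
    with A show ?case by simp
  qed simp
  show "independent (x ` A)"
  proof (rule independent_if_scalars_zero)
    fix f v assume f: "(\<Sum>v\<in>x ` A. scale (f v) v) = 0" and v: "v \<in> x ` A"
    then have "(\<Sum>a\<in>A. scale (f (x a)) (x a)) = 0"
      by (simp add: sum.reindex[OF inj])
    then show "f v = 0" using zero[of "\<lambda>a. f (x a)"] v by blast
  qed (use assms(1) in simp)
qed

end

section \<open>The vectors \<open>Fvec\<close> in the simple module\<close>

context simple_hw_module
begin

text \<open>\<open>EE Two\<close> commutes with \<open>FF One\<close>. So these vectors are highest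
  weight vectors for the second simple root, and start strings of their own.\<close>

lemma E_F1_string: "act (EE Two) ((act (FF One) ^^ c) \<eta>) = 0"
proof -
  have "(act (FF One) ^^ c) 0 = 0" by (induction c) simp_all
  then show ?thesis by (simp add: EE_FF_funpow_other hw_E)
qed

lemma hw_weights:
  "act (KK One) \<eta> = scale (qv powi (int m)) \<eta>" "act (KK Two) \<eta> = scale (qv powi (int n)) \<eta>"
  by (simp_all add: hw_K1 hw_K2)

lemma K2_F1_string:
  "act (KK Two) ((act (FF One) ^^ c) \<eta>) = scale (qv powi (int (n + c))) ((act (FF One) ^^ c) \<eta>)"
  using KK_FF_funpow[OF hw_weights(2), where j = One and k = c] by (simp add: cartan_def del: power_int_of_nat of_nat_add) simp

lemma Fvec_of_nat:
  "Fvec act \<eta> (int b) (int c) = scale (1 / (qfact 1 b * qfact 1 c))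
    ((act (FF Two) ^^ b) ((act (FF One) ^^ c) \<eta>))"
  by (simp add: Fvec_def act_mult act_divpow funpow_act_scale)

lemma Fvec_neg: "b < 0 \<or> c < 0 \<Longrightarrow> Fvec act \<eta> b c = 0"
  by (cases "c < 0") (simp_all add: Fvec_def act_mult act_divpow_neg)

lemma Fvec_weights:
  "act (KK One) (Fvec act \<eta> b c) = scale (qv powi (int m - 2 * c + b)) (Fvec act \<eta> b c)"
  "act (KK Two) (Fvec act \<eta> b c) = scale (qv powi (int n + c - 2 * b)) (Fvec act \<eta> b c)"
proof -
  have *: "act (KK One) (Fvec act \<eta> b c) = scale (qv powi (int m - 2 * c + b)) (Fvec act \<eta> b c) \<and>
    act (KK Two) (Fvec act \<eta> b c) = scale (qv powi (int n + c - 2 * b)) (Fvec act \<eta> b c)"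
  proof (cases "b < 0 \<or> c < 0")
    case False
    then obtain b' c' where bc: "b = int b'" "c = int c'"
      by (metis linorder_not_less nonneg_int_cases)
    have 1: "act (KK i) ((act (FF Two) ^^ b') ((act (FF One) ^^ c') \<eta>)) =
        scale (qv powi (a - c * cartan i One - b * cartan i Two))
          ((act (FF Two) ^^ b') ((act (FF One) ^^ c') \<eta>))"
      if "act (KK i) \<eta> = scale (qv powi a) \<eta>" for i a
      unfolding bc by (rule KK_FF_funpow[OF KK_FF_funpow[OF that]])
    show ?thesis
      using 1[OF hw_weights(1)] 1[OF hw_weights(2)]
      unfolding bc Fvec_of_nat
      by (simp add: act_scale cartan_def mult.commute)
  qed (simp add: Fvec_neg)
  show "act (KK One) (Fvec act \<eta> b c) = scale (qv powi (int m - 2 * c + b)) (Fvec act \<eta> b c)"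
    "act (KK Two) (Fvec act \<eta> b c) = scale (qv powi (int n + c - 2 * b)) (Fvec act \<eta> b c)"
    using * by auto
qed

text \<open>Two strings in succession: along \<open>FF One\<close> from weight \<open>m\<close>,
  then along \<open>FF Two\<close> from weight \<open>n + c\<close>.\<close>

lemma Fvec_nonzero:
  assumes "c \<le> m" "b \<le> n + c"
  shows "Fvec act \<eta> (int b) (int c) \<noteq> 0"
proof -
  have "(act (FF One) ^^ c) \<eta> \<noteq> 0"
    by (rule FF_string_nonzero[OF hw_E hw_weights(1) hw_nonzero assms(1)])
  then have "(act (FF Two) ^^ b) ((act (FF One) ^^ c) \<eta>) \<noteq> 0"
    by (rule FF_string_nonzero[OF E_F1_string K2_F1_string _ assms(2)])
  then show ?thesis
    by (simp add: Fvec_of_nat qfact_nonzero)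
qed

lemma FF2_Fvec: "act (FF Two) (Fvec act \<eta> b c) = scale (qint 1 (b + 1)) (Fvec act \<eta> (b + 1) c)"
proof (cases "b < 0 \<or> c < 0")
  case True
  \<comment> \<open>At \<open>b = - 1\<close> the vector on the right may be nonzero, but its
    coefficient is \<open>[0] = 0\<close>.\<close>
  then show ?thesis by (cases "b = - 1") (auto simp: Fvec_neg)
next
  case False
  then obtain b' c' where bc: "b = int b'" "c = int c'"
    by (metis linorder_not_less nonneg_int_cases)
  have "int b' + 1 = int (Suc b')" by simp
  then show ?thesis
    unfolding bc using qint_eq_0_iff[of 1 "int (Suc b')"]
    by (simp only: Fvec_of_nat) (simp add: act_scale qfact_Suc)
qed

lemma EE1_Fvec: "act (EE One) (Fvec act \<eta> b c) = scale (qint 1 (int m - c + 1)) (Fvec act \<eta> b (c - 1))"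
proof (cases "b < 0 \<or> c < 0")
  case True
  then show ?thesis by (auto simp: Fvec_neg)
next
  case False
  then obtain b' c' where bc: "b = int b'" "c = int c'"
    by (metis linorder_not_less nonneg_int_cases)
  have zero: "(act (FF Two) ^^ k) 0 = 0" for k by (induction k) simp_all
  show ?thesis
  proof (cases c')
    case 0
    then show ?thesis
      unfolding bc Fvec_of_nat by (simp add: act_scale EE_FF_funpow_other hw_E zero Fvec_neg)
  next
    case (Suc k)
    have "int c' - 1 = int k" using Suc by simp
    then show ?thesis
      unfolding bc using Suc qint_eq_0_iff[of 1 "int (Suc k)"]
        EE_FF_string[OF hw_E hw_weights(1), of k]
      by (simp only: Fvec_of_nat) (simp add: act_scale EE_FF_funpow_other funpow_act_scale qfact_Suc add.commute del: funpow.simps)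
  qed
qed

lemma Bgen_Two_Fvec:
  "act (Bgen \<sigma> Two) (Fvec act \<eta> b c) = scale (qint 1 (b + 1)) (Fvec act \<eta> (b + 1) c) +
    scale (qv powi (int (\<sigma> Two) - int n - c + 2 * b) * qint 1 (int m - c + 1)) (Fvec act \<eta> b (c - 1))"
proof -
  have "qv ^ \<sigma> Two * qv powi (- (int n + c - 2 * b)) = qv powi (int (\<sigma> Two) - int n - c + 2 * b)"
    unfolding power_int_of_nat[symmetric] qv_powi_add[symmetric] by (simp add: algebra_simps)
  then show ?thesis
    by (simp add: Bgen_def act_add_left act_uscale act_mult FF2_Fvec Kinv_weight[OF Fvec_weights(2)]
        act_scale EE1_Fvec mult.commute mult.left_commute)
qed

text \<open>\<open>EE Two\<close> kills every vector of the string, so only the summand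
  \<open>FF One\<close> of \<open>Bgen \<sigma> One\<close> acts.\<close>

lemma Bgen_One_funpow: "(act (Bgen \<sigma> One) ^^ c) \<eta> = (act (FF One) ^^ c) \<eta>"
proof (induction c)
  case (Suc c)
  have "act (Kinv One) ((act (FF One) ^^ c) \<eta>) = scale (qv powi (- (int m - int c * cartan One One))) ((act (FF One) ^^ c) \<eta>)"
    by (rule Kinv_weight[OF KK_FF_funpow[OF hw_weights(1)]])
  then show ?case
    using Suc by (simp add: Bgen_def act_add_left act_uscale act_mult act_scale E_F1_string)
qed simp

end

section \<open>Expansion of the invariant vectors\<close>

lemma fcoeff_0 [simp]: "fcoeff N M 0 = 1"
  by (simp add: fcoeff_def)

text \<open>Coefficient comparison for the passage from \<open>b\<close> to \<open>b + 1\<close>,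
  where \<open>N\<close> drops by one. \<open>qint_split\<close> yields the two terms, and
  absorption rewrites the second with index \<open>j\<close>.\<close>

lemma fcoeff_Suc:
  "qint 1 (b + 1) * fcoeff (N - 1) M (Suc j) =
    qint 1 (b - int j) * fcoeff N M (Suc j) + qv powi (b - N - int j) * qint 1 (int M + int j + 1) * fcoeff N M j"
proof -
  let ?k = "int (Suc j)"
  let ?e = "- (?k * N) - ?k * (?k + 1) div 2"
  have T: "?k * (?k + 1) div 2 = int j * (int j + 1) div 2 + ?k"
    using triangular_add[of j 1] by (simp add: algebra_simps)
  have absorb: "qint 1 (int M + int j + 1) * qbinom 1 (int M + int j) j = qint 1 ?k * qbinom 1 (int M + ?k) (Suc j)"
    using qbinom_Suc_absorb[of 1 j "int M + int j"] by (simp add: algebra_simps)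
  have e1: "qv powi (- (?k * (N - 1)) - ?k * (?k + 1) div 2) = qv powi ?k * qv powi ?e"
    unfolding qv_powi_add[symmetric] by (simp add: algebra_simps)
  have e2: "qv powi (b - N - int j) * qv powi (- (int j * N) - int j * (int j + 1) div 2) = qv powi (b + 1) * qv powi ?e"
    unfolding qv_powi_add[symmetric] T by (simp add: algebra_simps)
  have "qint 1 (b + 1) * fcoeff (N - 1) M (Suc j) = (qint 1 (b + 1) * qv powi ?k) * (qv powi ?e * qbinom 1 (int M + ?k) (Suc j))"
    unfolding fcoeff_def e1 by (simp only: ac_simps)
  also have "\<dots> = qint 1 (b - int j) * fcoeff N M (Suc j) +
      (qv powi (b + 1) * qv powi ?e) * (qint 1 ?k * qbinom 1 (int M + ?k) (Suc j))"
    unfolding qint_split fcoeff_def by (simp add: algebra_simps)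
  also have "(qv powi (b + 1) * qv powi ?e) * (qint 1 ?k * qbinom 1 (int M + ?k) (Suc j)) =
      qv powi (b - N - int j) * qint 1 (int M + int j + 1) * fcoeff N M j"
    unfolding e2[symmetric] absorb[symmetric] fcoeff_def by (simp only: ac_simps)
  finally show ?thesis .
qed

definition ivec :: "(idx \<Rightarrow> nat) \<Rightarrow> (Usl3 \<Rightarrow> 'v \<Rightarrow> 'v) \<Rightarrow> 'v \<Rightarrow> nat \<Rightarrow> nat \<Rightarrow> 'v" where
  "ivec \<sigma> act \<eta> b c = act (divpow (Bgen \<sigma> Two) (int b) * divpow (Bgen \<sigma> One) (int c)) \<eta>"

context simple_hw_module
begin

lemma ivec_0: "ivec \<sigma> act \<eta> 0 c = Fvec act \<eta> 0 (int c)"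
  using Fvec_of_nat[of 0 c]
  by (simp add: ivec_def act_mult act_divpow[of _ 0, simplified] act_divpow Bgen_One_funpow)

lemma ivec_Suc:
  "scale (qint 1 (int b + 1)) (ivec \<sigma> act \<eta> (Suc b) c) = act (Bgen \<sigma> Two) (ivec \<sigma> act \<eta> b c)"
  using qint_eq_0_iff[of 1 "int (Suc b)"] qint_eq_0_iff[of 1 "int b + 1"]
  unfolding ivec_def act_mult act_divpow
  by (simp add: act_scale funpow_act_scale qfact_Suc add.commute)

lemma ivec_expansion:
  assumes "c \<le> m"
  shows "ivec \<sigma> act \<eta> b c =
    (\<Sum>k\<le>c. scale (fcoeff (int n - int b + int c - int (\<sigma> Two)) (m - c) k)
      (Fvec act \<eta> (int b - int k) (int c - int k)))"
proof (induction b)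
  case 0
  have "(\<Sum>k\<le>c. scale (fcoeff (int n - int 0 + int c - int (\<sigma> Two)) (m - c) k)
      (Fvec act \<eta> (int 0 - int k) (int c - int k))) = (\<Sum>k\<in>{0::nat}. Fvec act \<eta> 0 (int c))"
    by (rule sum.mono_neutral_cong_right) (auto simp: Fvec_neg)
  then show ?case by (simp add: ivec_0)
next
  case (Suc b)
  let ?N = "int n - int b + int c - int (\<sigma> Two)"
  define e where "e k = Fvec act \<eta> (int (Suc b) - int k) (int c - int k)" for k
  let ?a = "fcoeff ?N (m - c)"
  let ?a' = "fcoeff (?N - 1) (m - c)"
  let ?r = "\<lambda>k. qv powi (int b - ?N - int k) * qint 1 (int (m - c) + int k + 1)"
  have step: "act (Bgen \<sigma> Two) (scale (?a k) (Fvec act \<eta> (int b - int k) (int c - int k))) =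
      scale (qint 1 (int b - int k + 1) * ?a k) (e k) + scale (?r k * ?a k) (e (Suc k))" for k
    using assms by (simp add: act_scale Bgen_Two_Fvec scale_right_distrib e_def of_nat_diff algebra_simps)
  have "scale (qint 1 (int b + 1)) (ivec \<sigma> act \<eta> (Suc b) c) =
      (\<Sum>k\<le>c. scale (qint 1 (int b - int k + 1) * ?a k) (e k)) + (\<Sum>k\<le>c. scale (?r k * ?a k) (e (Suc k)))"
    unfolding ivec_Suc Suc.IH act_sum step sum.distrib ..
  \<comment> \<open>The term \<open>k = c\<close> vanishes: its vector has the \<open>FF One\<close>
    exponent \<open>-1\<close>.\<close>
  also have "(\<Sum>k\<le>c. scale (?r k * ?a k) (e (Suc k))) = (\<Sum>k<c. scale (?r k * ?a k) (e (Suc k)))"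
    by (simp add: lessThan_Suc_atMost[symmetric] e_def Fvec_neg)
  also have "(\<Sum>k\<le>c. scale (qint 1 (int b - int k + 1) * ?a k) (e k)) =
      scale (qint 1 (int b + 1)) (e 0) + (\<Sum>k<c. scale (qint 1 (int b - int k) * ?a (Suc k)) (e (Suc k)))"
    by (simp add: sum.atMost_shift)
  also have "\<dots> + (\<Sum>k<c. scale (?r k * ?a k) (e (Suc k))) =
      scale (qint 1 (int b + 1)) (e 0) + (\<Sum>k<c. scale (qint 1 (int b + 1) * ?a' (Suc k)) (e (Suc k)))"
    unfolding fcoeff_Suc scale_left_distrib sum.distrib by (simp only: add.assoc)
  also have "\<dots> = scale (qint 1 (int b + 1)) (\<Sum>k\<le>c. scale (?a' k) (e k))"
    by (simp add: sum.atMost_shift scale_right_distrib scale_sum_right)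
  finally have "ivec \<sigma> act \<eta> (Suc b) c = (\<Sum>k\<le>c. scale (?a' k) (e k))"
    using qint_eq_0_iff[of 1 "int b + 1"] by simp
  moreover have "?N - 1 = int n - int (Suc b) + int c - int (\<sigma> Two)" by simp
  ultimately show ?case unfolding e_def by simp
qed

end

section \<open>The icanonical basis element\<close>

lemma Uiota_power: "x \<in> Uiota \<sigma> \<Longrightarrow> x ^ k \<in> Uiota \<sigma>"
  by (induction k) (simp_all add: Uiota.one Uiota.mult)

lemma psi_iota_divpow:
  assumes "is_psi_iota \<sigma> \<psi>" "x \<in> Uiota \<sigma>" "\<psi> x = x"
  shows "divpow x (int k) \<in> Uiota \<sigma>" "\<psi> (divpow x (int k)) = divpow x (int k)"
proof -
  have "\<psi> (x ^ k) = x ^ k"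
    using assms Uiota_power[OF assms(2)] by (induction k) (simp_all add: is_psi_iota_def)
  then show "divpow x (int k) \<in> Uiota \<sigma>" "\<psi> (divpow x (int k)) = divpow x (int k)"
    using assms Uiota_power[OF assms(2), of k] by (simp_all add: divpow_def Uiota.scale is_psi_iota_def)
qed

lemma psi_iota_ivec:
  assumes "is_psi_iota \<sigma> \<psi>" "is_module_psi_iota \<sigma> \<psi> scale act \<eta> \<Psi>"
  shows "\<Psi> (ivec \<sigma> act \<eta> b c) = ivec \<sigma> act \<eta> b c"
proof -
  have B: "divpow (Bgen \<sigma> i) (int k) \<in> Uiota \<sigma>"
    "\<psi> (divpow (Bgen \<sigma> i) (int k)) = divpow (Bgen \<sigma> i) (int k)" for i k
    using psi_iota_divpow[OF assms(1) Uiota.B] assms(1) by (simp_all add: is_psi_iota_def)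
  then have "divpow (Bgen \<sigma> Two) (int b) * divpow (Bgen \<sigma> One) (int c) \<in> Uiota \<sigma>"
    by (intro Uiota.mult)
  moreover have "\<psi> (divpow (Bgen \<sigma> Two) (int b) * divpow (Bgen \<sigma> One) (int c)) =
      divpow (Bgen \<sigma> Two) (int b) * divpow (Bgen \<sigma> One) (int c)"
    using assms(1) B by (simp add: is_psi_iota_def)
  ultimately show ?thesis
    using assms(2) by (simp add: is_module_psi_iota_def ivec_def)
qed

section \<open>Triangularity, uniqueness and the coefficients\<close>

text \<open>The setting common to both modules of the final theorem, which uses it once with
  \<open>c\<close> and once with \<open>\<theta>\<close> in place of \<open>c\<close>.\<close>

locale icanonical_chain = simple_hw_module scale act \<eta> m n
  for scale :: "Qq \<Rightarrow> 'v::ab_group_add \<Rightarrow> 'v" and act \<eta> m n +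
  fixes \<sigma> :: "idx \<Rightarrow> nat" and \<psi> :: "Usl3 \<Rightarrow> Usl3" and \<Psi> :: "'v \<Rightarrow> 'v" and b c :: nat and \<gamma> :: int
  assumes psi: "is_psi_iota \<sigma> \<psi>"
    and Psi: "is_module_psi_iota \<sigma> \<psi> scale act \<eta> \<Psi>"
    and sigma: "\<sigma> Two \<le> 1"
    and c_le: "c \<le> m"
    and b_le: "int n - int b + int c \<ge> 0"
    and gamma: "int m - int n + int b - 2 * int c + int (\<sigma> Two) = 2 * \<gamma>" "\<gamma> > 0"
begin

definition e :: "nat \<Rightarrow> 'v" where
  "e t = Fvec act \<eta> (int b - int t) (int c - int t)"

definition f :: "nat \<Rightarrow> 'v" where
  "f t = ivec \<sigma> act \<eta> (b - t) (c - t)"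

abbreviation N :: int where "N \<equiv> int n - int b + int c - int (\<sigma> Two)"
abbreviation K :: nat where "K \<equiv> min b c"

lemma e_zero: "K < t \<Longrightarrow> e t = 0"
  unfolding e_def by (rule Fvec_neg) linarith

lemma e_nonzero:
  assumes "t \<le> K"
  shows "e t \<noteq> 0"
proof -
  have "e t = Fvec act \<eta> (int (b - t)) (int (c - t))"
    using assms by (simp add: e_def of_nat_diff)
  also have "\<dots> \<noteq> 0"
    using assms c_le b_le by (intro Fvec_nonzero) auto
  finally show ?thesis .
qed

text \<open>The \<open>KK One\<close> weight of \<open>e t\<close> has exponent
  \<open>m - 2c + b + t\<close>, so different \<open>t\<close> have different weights.\<close>

lemma e_inj: "inj_on e {..K}"
  and e_independent: "independent (e ` {..K})"
proof -
  let ?wt = "\<lambda>t. int m - 2 * (int c - int t) + (int b - int t)"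
  have inj: "inj_on ?wt {..K}"
    by (rule inj_onI) simp
  have wt: "act (KK One) (e t) = scale (qv powi ?wt t) (e t)" for t
    unfolding e_def by (rule Fvec_weights)
  show "inj_on e {..K}"
    by (rule independent_weight_vectors(1)[OF _ inj wt]) (simp_all add: e_nonzero del: min.bounded_iff)
  show "independent (e ` {..K})"
    by (rule independent_weight_vectors(2)[OF _ inj wt]) (simp_all add: e_nonzero del: min.bounded_iff)
qed

text \<open>Lowering both \<open>b\<close> and \<open>c\<close> by \<open>t\<close> keeps
  \<open>N\<close> and raises \<open>m - c\<close> by \<open>t\<close>.\<close>

lemma f_expansion:
  assumes "t \<le> K"
  shows "f t = (\<Sum>j\<in>{t..K}. scale (fcoeff N (m - c + t) (j - t)) (e j))"
proof -
  have M: "m - (c - t) = m - c + t"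
    using assms c_le by simp
  have N: "int n - int (b - t) + int (c - t) - int (\<sigma> Two) = N"
    using assms by (simp add: of_nat_diff)
  have "f t = (\<Sum>k\<le>c - t. scale (fcoeff N (m - c + t) k)
      (Fvec act \<eta> (int (b - t) - int k) (int (c - t) - int k)))"
    unfolding f_def using ivec_expansion[of "c - t" \<sigma> "b - t"] c_le unfolding M N by simp
  also have "\<dots> = (\<Sum>k\<le>K - t. scale (fcoeff N (m - c + t) k) (e (t + k)))"
  proof (rule sum.mono_neutral_cong_right)
    have eq: "Fvec act \<eta> (int (b - t) - int k) (int (c - t) - int k) = e (t + k)" for k
      using assms by (simp add: e_def of_nat_diff diff_diff_eq)
    show "scale (fcoeff N (m - c + t) k) (Fvec act \<eta> (int (b - t) - int k) (int (c - t) - int k)) =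
        scale (fcoeff N (m - c + t) k) (e (t + k))" for k
      unfolding eq ..
    show "\<forall>k\<in>{..c - t} - {..K - t}. scale (fcoeff N (m - c + t) k)
        (Fvec act \<eta> (int (b - t) - int k) (int (c - t) - int k)) = 0"
    proof
      fix k assume "k \<in> {..c - t} - {..K - t}"
      then have "K < t + k" by auto
      then show "scale (fcoeff N (m - c + t) k) (Fvec act \<eta> (int (b - t) - int k) (int (c - t) - int k)) = 0"
        unfolding eq by (simp add: e_zero del: min_less_iff_disj)
    qed
  qed auto
  also have "\<dots> = (\<Sum>j\<in>{t..K}. scale (fcoeff N (m - c + t) (j - t)) (e j))"
    using assms by (intro sum.reindex_bij_witness[of _ "\<lambda>j. j - t" "\<lambda>k. t + k"]) auto
  finally show ?thesis .
qed

lemma Psi_f: "\<Psi> (f t) = f t"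
  unfolding f_def by (rule psi_iota_ivec[OF psi Psi])

lemma Psi_add: "\<Psi> (v + w) = \<Psi> v + \<Psi> w"
  and Psi_scale: "\<Psi> (scale a v) = scale (qbar a) (\<Psi> v)"
  using Psi by (simp_all add: is_module_psi_iota_def)

lemma Psi_zero [simp]: "\<Psi> 0 = 0"
  using Psi_add[of 0 0] by simp

lemma Psi_diff: "\<Psi> (v - w) = \<Psi> v - \<Psi> w"
  using Psi_add[of "v - w" w] by (simp add: eq_diff_eq)

lemma Psi_sum: "\<Psi> (sum g A) = (\<Sum>x\<in>A. \<Psi> (g x))"
  by (induction A rule: infinite_finite_induct) (simp_all add: Psi_add)

text \<open>Downward induction on \<open>t\<close>: the fixed vector \<open>f t\<close> is
  \<open>e t\<close> plus terms of larger index, whose images are already controlled.\<close>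

lemma Psi_e_triangular:
  assumes "t \<le> K"
  shows "\<Psi> (e t) - e t \<in> span (e ` {t<..K})"
  using assms
proof (induction "K - t" arbitrary: t rule: less_induct)
  case less
  define g where "g j = fcoeff N (m - c + t) (j - t)" for j
  have split: "{t..K} = insert t {t<..K}"
    using less.prems by auto
  have f: "f t = e t + (\<Sum>j\<in>{t<..K}. scale (g j) (e j))"
    unfolding f_expansion[OF less.prems] split g_def by simp
  have "\<Psi> (e t) + (\<Sum>j\<in>{t<..K}. scale (qbar (g j)) (\<Psi> (e j))) = f t"
    using Psi_f[of t] unfolding f by (simp add: Psi_add Psi_sum Psi_scale)
  then have eq: "\<Psi> (e t) - e t = (\<Sum>j\<in>{t<..K}. scale (g j) (e j)) - (\<Sum>j\<in>{t<..K}. scale (qbar (g j)) (\<Psi> (e j)))"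
    unfolding f by (simp add: algebra_simps)
  have ej: "e j \<in> span (e ` {t<..K})" if "j \<in> {t<..K}" for j
    using that by (intro span_base) auto
  moreover have "\<Psi> (e j) \<in> span (e ` {t<..K})" if j: "j \<in> {t<..K}" for j
  proof -
    have "\<Psi> (e j) - e j \<in> span (e ` {j<..K})"
      using j by (intro less.hyps) auto
    also have "\<dots> \<subseteq> span (e ` {t<..K})"
      using j by (intro span_mono) auto
    finally have "\<Psi> (e j) - e j + e j \<in> span (e ` {t<..K})"
      using ej[OF j] by (rule span_add)
    then show ?thesis by simp
  qed
  ultimately show ?case
    unfolding eq by (intro span_diff span_sum span_scale) auto
qed

text \<open>Induction on \<open>t\<close>: once the earlier coefficients vanish, the equation modulo
  the span of the later vectors gives \<open>qbar (d t) = d t\<close>, and \<open>qinvZ\<close> has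
  no nonzero fixed element.\<close>

lemma Psi_fixed_zero:
  assumes d: "\<And>j. j \<le> K \<Longrightarrow> d j \<in> qinvZ"
    and fixed: "\<Psi> (\<Sum>j\<le>K. scale (d j) (e j)) = (\<Sum>j\<le>K. scale (d j) (e j))"
    and "t \<le> K"
  shows "d t = 0"
  using \<open>t \<le> K\<close>
proof (induction t rule: less_induct)
  case (less t)
  define S where "S = span (e ` {t<..K})"
  define r where "r = (\<Sum>j\<in>{t<..K}. scale (d j) (e j))"
  have "(\<Sum>j\<le>K. scale (d j) (e j)) = (\<Sum>j\<in>insert t {t<..K}. scale (d j) (e j))"
    using less by (intro sum.mono_neutral_right) auto
  then have w: "(\<Sum>j\<le>K. scale (d j) (e j)) = scale (d t) (e t) + r"
    unfolding r_def by simp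
  have ej: "e j \<in> S" if "j \<in> {t<..K}" for j
    unfolding S_def using that by (intro span_base) auto
  have \<Psi>ej: "\<Psi> (e j) \<in> S" if j: "j \<in> {t<..K}" for j
  proof -
    have "\<Psi> (e j) - e j \<in> span (e ` {j<..K})"
      using j by (intro Psi_e_triangular) auto
    also have "\<dots> \<subseteq> S"
      unfolding S_def using j by (intro span_mono) auto
    finally have "\<Psi> (e j) - e j + e j \<in> S"
      using ej[OF j] unfolding S_def by (rule span_add)
    then show ?thesis by simp
  qed
  have "r \<in> S" and "\<Psi> r \<in> S"
    unfolding r_def Psi_sum Psi_scale using ej \<Psi>ej
    unfolding S_def by (auto intro!: span_sum span_scale)
  moreover have "\<Psi> (e t) - e t \<in> S"
    unfolding S_def using Psi_e_triangular[OF less.prems] .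
  ultimately have "scale (qbar (d t)) (\<Psi> (e t) - e t) + \<Psi> r - r \<in> S"
    unfolding S_def by (blast intro: span_add span_diff span_scale)
  moreover have "scale (qbar (d t)) (\<Psi> (e t) - e t) + \<Psi> r - r = scale (d t - qbar (d t)) (e t)"
    using fixed unfolding w
    by (simp add: Psi_add Psi_scale scale_right_diff_distrib scale_left_diff_distrib algebra_simps)
  ultimately have *: "scale (d t - qbar (d t)) (e t) \<in> S" by simp
  have "d t - qbar (d t) = 0"
  proof (rule ccontr)
    assume nz: "d t - qbar (d t) \<noteq> 0"
    have "e t \<in> S"
      using span_scale[OF *[unfolded S_def], of "1 / (d t - qbar (d t))"] nz unfolding S_def by simp
    also have "S \<subseteq> span (e ` {..K} - {e t})"
    proof -
      have "e j \<noteq> e t" if "j \<in> {t<..K}" for j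
        using inj_onD[OF e_inj, of j t] that less.prems by fastforce
      then show ?thesis
        unfolding S_def by (intro span_mono) auto
    qed
    finally show False
      using e_independent less.prems unfolding dependent_def by auto
  qed
  then show ?case
    using qinvZ_qbar_fixed[OF d[OF less.prems]] by simp
qed

definition ican :: 'v where
  "ican = (\<Sum>j\<le>K. scale (omega_coeff \<gamma> N j) (e j))"

text \<open>Expanding the \<open>f t\<close> and exchanging sums gives the sums of
  \<open>omega_coeff_expansion\<close>, which applies because
  \<open>N + 2 * \<gamma> = m - c\<close>.\<close>

lemma ican_eq_f: "ican = (\<Sum>t\<le>K. scale (binv_coeff \<gamma> t) (f t))"
proof -
  have "(\<Sum>t\<le>K. scale (binv_coeff \<gamma> t) (f t)) =
      (\<Sum>t\<le>K. \<Sum>j\<in>{t..K}. scale (binv_coeff \<gamma> t * fcoeff N (m - c + t) (j - t)) (e j))"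
    by (rule sum.cong) (simp_all add: f_expansion scale_sum_right)
  also have "\<dots> = (\<Sum>t\<le>K. \<Sum>j\<in>{j\<in>{..K}. t \<le> j}. scale (binv_coeff \<gamma> t * fcoeff N (m - c + t) (j - t)) (e j))"
    by (intro sum.cong) auto
  also have "\<dots> = (\<Sum>j\<le>K. \<Sum>t\<in>{t\<in>{..K}. t \<le> j}. scale (binv_coeff \<gamma> t * fcoeff N (m - c + t) (j - t)) (e j))"
    by (rule sum.swap_restrict) simp_all
  also have "\<dots> = (\<Sum>j\<le>K. \<Sum>t\<le>j. scale (binv_coeff \<gamma> t * fcoeff N (m - c + t) (j - t)) (e j))"
    by (intro sum.cong) auto
  also have "\<dots> = ican"
  proof -
    have "omega_coeff \<gamma> N j = (\<Sum>t\<le>j. binv_coeff \<gamma> t * fcoeff N (m - c + t) (j - t))" for j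
      using omega_coeff_expansion[of "m - c" N \<gamma> j] gamma(1) c_le by (simp add: of_nat_diff)
    then show ?thesis
      unfolding ican_def by (simp add: scale_sum_left)
  qed
  finally show ?thesis ..
qed

lemma Psi_ican: "\<Psi> ican = ican"
  unfolding ican_eq_f by (simp add: Psi_sum Psi_scale Psi_f)

lemma sum_extend:
  "e 0 + (\<Sum>t = 1..c. scale (a t) (e t)) = (\<Sum>j\<le>K. scale (if j = 0 then 1 else a j) (e j))"
proof -
  have "e 0 + (\<Sum>t = 1..c. scale (a t) (e t)) = (\<Sum>j\<in>insert 0 {1..c}. scale (if j = 0 then 1 else a j) (e j))"
    by simp
  also have "\<dots> = (\<Sum>j\<le>K. scale (if j = 0 then 1 else a j) (e j))"
    by (rule sum.mono_neutral_right) (auto simp: not_le e_zero)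
  finally show ?thesis .
qed

text \<open>The value 0 at \<open>t = 0\<close> is outside the range of summation. It serves the
  definition of \<open>icanonical\<close>, which wants all \<open>a \<theta>\<close> in
  \<open>qinvZ\<close>, whereas \<open>omega_coeff\<close> is 1 there.\<close>

lemma ican_eq: "ican = e 0 + (\<Sum>t = 1..c. scale (if t = 0 then 0 else omega_coeff \<gamma> N t) (e t))"
  unfolding sum_extend ican_def by (rule sum.cong) auto

text \<open>\<open>ican\<close> has the required form; the difference from any other candidate is
  fixed, with all coefficients in \<open>qinvZ\<close>, hence zero.\<close>

lemma icanonical_eq: "icanonical scale act \<eta> \<Psi> b c = ican"
proof -
  have e: "Fvec act \<eta> (int b) (int c) = e 0"
    "\<And>t. Fvec act \<eta> (int b - int t) (int c - int t) = e t"
    by (simp_all add: e_def)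
  have qinvZ: "(if t = 0 then 0 else omega_coeff \<gamma> N t) \<in> qinvZ" for t
    using omega_coeff_qinvZ[of \<gamma> N t] gamma(2) sigma b_le by auto
  show ?thesis
    unfolding icanonical_def e
  proof (rule the_equality, intro conjI exI allI)
    show "\<Psi> ican = ican" by (rule Psi_ican)
    show "(if t = 0 then 0 else omega_coeff \<gamma> N t) \<in> qinvZ" for t by (rule qinvZ)
    show "ican = e 0 + (\<Sum>t = 1..c. scale (if t = 0 then 0 else omega_coeff \<gamma> N t) (e t))"
      by (rule ican_eq)
  next
    fix v
    assume "\<Psi> v = v \<and> (\<exists>a. (\<forall>t. a t \<in> qinvZ) \<and> v = e 0 + (\<Sum>t = 1..c. scale (a t) (e t)))"
    then obtain a where v: "\<Psi> v = v" "v = e 0 + (\<Sum>t = 1..c. scale (a t) (e t))"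
      and a: "\<And>t. a t \<in> qinvZ" by blast
    define d where "d j = (if j = 0 then 0 else a j - omega_coeff \<gamma> N j)" for j
    have "v - ican = (\<Sum>j\<le>K. scale (d j) (e j))"
      unfolding v(2) ican_eq sum_extend sum_subtractf[symmetric]
      by (rule sum.cong) (auto simp: d_def scale_left_diff_distrib)
    moreover have "\<Psi> (v - ican) = v - ican"
      by (simp add: Psi_diff v(1) Psi_ican)
    moreover have "d j \<in> qinvZ" for j
      using qinvZ_diff[OF a qinvZ, of j j] by (cases "j = 0") (simp_all add: d_def)
    ultimately have "d j = 0" if "j \<le> K" for j
      using Psi_fixed_zero[of d j] that by simp
    with \<open>v - ican = _\<close> show "v = ican" by simp
  qed
qed

text \<open>The nonzero \<open>e t\<close> are exactly those with \<open>t \<le> K\<close>, and they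
  are independent. For \<open>b < t\<close> the vector is 0, lies outside the basis, and
  \<open>representation\<close> returns 0.\<close>

lemma icoeff_eq:
  assumes "t \<le> c"
  shows "icoeff scale act \<eta> \<Psi> b c t = (if t \<le> b then omega_coeff \<gamma> N t else 0)"
proof -
  let ?B = "e ` {..K}"
  have B: "(\<lambda>t. Fvec act \<eta> (int b - int t) (int c - int t)) ` {0..c} - {0} = ?B"
  proof -
    have "(\<lambda>t. Fvec act \<eta> (int b - int t) (int c - int t)) ` {0..c} = e ` {0..c}"
      by (simp add: e_def)
    moreover have "e ` {0..c} - {0} = ?B"
    proof -
      have "e ` {0..c} - {0} = e ` {t \<in> {0..c}. e t \<noteq> 0}"
        by auto
      also have "{t \<in> {0..c}. e t \<noteq> 0} = {..K}"
      proof (intro set_eqI iffI)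
        fix t assume "t \<in> {t \<in> {0..c}. e t \<noteq> 0}"
        then show "t \<in> {..K}" using e_zero[of t] by force
      next
        fix t assume "t \<in> {..K}"
        then show "t \<in> {t \<in> {0..c}. e t \<noteq> 0}" using e_nonzero[of t] by simp
      qed
      finally show ?thesis .
    qed
    ultimately show ?thesis by simp
  qed
  have icoeff: "icoeff scale act \<eta> \<Psi> b c t = representation ?B ican (e t)"
    unfolding icoeff_def B icanonical_eq by (simp add: e_def)
  show ?thesis
  proof (cases "t \<le> b")
    case True
    have base: "e j \<in> span ?B" if "j \<le> K" for j
      using that by (intro span_base) auto
    have "representation ?B ican (e t) =
        (\<Sum>j\<le>K. representation ?B (scale (omega_coeff \<gamma> N j) (e j)) (e t))"
      unfolding ican_def using base
      by (subst representation_sum[OF e_independent]) (auto intro: span_scale)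
    also have "\<dots> = (\<Sum>j\<le>K. if j = t then omega_coeff \<gamma> N j else 0)"
    proof (rule sum.cong)
      fix j assume j: "j \<in> {..K}"
      have "e j = e t \<longleftrightarrow> j = t"
        using e_inj j True assms by (auto simp: inj_on_def)
      then show "representation ?B (scale (omega_coeff \<gamma> N j) (e j)) (e t) =
          (if j = t then omega_coeff \<gamma> N j else 0)"
        using j base[of j]
        by (auto simp: representation_scale[OF e_independent] representation_basis[OF e_independent])
    qed simp
    also have "\<dots> = omega_coeff \<gamma> N t"
      using True assms by simp
    finally show ?thesis using True icoeff by simp
  next
    case False
    then have "e t \<notin> ?B"
      using e_zero[of t] e_nonzero by auto
    then show ?thesis
      using False icoeff representation_ne_zero[of ?B ican "e t"] by auto
  qed
qed

lemma icanonical_expansion: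
  "icanonical scale act \<eta> \<Psi> b c = Fvec act \<eta> (int b) (int c) +
    (\<Sum>t = 1..c. scale (icoeff scale act \<eta> \<Psi> b c t) (Fvec act \<eta> (int b - int t) (int c - int t)))"
proof -
  have "(\<Sum>t = 1..c. scale (icoeff scale act \<eta> \<Psi> b c t) (e t)) =
      (\<Sum>t = 1..c. scale (if t = 0 then 0 else omega_coeff \<gamma> N t) (e t))"
    \<comment> \<open>The two coefficients may differ for \<open>t > b\<close>, but there
      \<open>e t = 0\<close>.\<close>
    by (rule sum.cong) (auto simp: icoeff_eq e_zero)
  then show ?thesis
    unfolding icanonical_eq ican_eq by (simp add: e_def)
qed

end

text \<open>Passing to \<open>m - (c - \<theta>)\<close>, \<open>n + (c - \<theta>)\<close> and
  \<open>\<theta>\<close> preserves \<open>N\<close> and \<open>\<gamma>\<close>, so both modules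
  give the same \<open>omega_coeff\<close>. The closed formula concerns
  \<open>\<theta> \<le> b\<close>, where the vector is nonzero.\<close>

theorem proposition8p1:
  fixes \<sigma> :: "idx \<Rightarrow> nat" and \<psi> :: "Usl3 \<Rightarrow> Usl3"
    and scaleV :: "Qq \<Rightarrow> 'v::ab_group_add \<Rightarrow> 'v" and actV :: "Usl3 \<Rightarrow> 'v \<Rightarrow> 'v"
    and \<eta>V :: 'v and \<Psi>V :: "'v \<Rightarrow> 'v"
    and scaleW :: "Qq \<Rightarrow> 'w::ab_group_add \<Rightarrow> 'w" and actW :: "Usl3 \<Rightarrow> 'w \<Rightarrow> 'w"
    and \<eta>W :: 'w and \<Psi>W :: "'w \<Rightarrow> 'w"
    and m n b c \<theta> :: nat and \<alpha> \<gamma> :: int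
  assumes "(\<sigma> One, \<sigma> Two) \<in> {(1, 0), (0, 1)}"
    and "is_psi_iota \<sigma> \<psi>"
    and "simple_hw_module scaleV actV \<eta>V m n"
    and "is_module_psi_iota \<sigma> \<psi> scaleV actV \<eta>V \<Psi>V"
    and "\<theta> \<le> c"
    and "simple_hw_module scaleW actW \<eta>W (m - (c - \<theta>)) (n + (c - \<theta>))"
    and "is_module_psi_iota \<sigma> \<psi> scaleW actW \<eta>W \<Psi>W"
    and "c \<le> m"
    and "int n - int b + int c \<ge> 0"
    and "\<alpha> = int m - int n + int b - 2 * int c + int (\<sigma> Two)"
    and "\<alpha> > 0" and "even \<alpha>"
    and "\<gamma> = \<alpha> div 2"
  shows "icanonical scaleV actV \<eta>V \<Psi>V b c =
           Fvec actV \<eta>V (int b) (int c) +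
           (\<Sum>t = 1..c. scaleV (icoeff scaleV actV \<eta>V \<Psi>V b c t)
                              (Fvec actV \<eta>V (int b - int t) (int c - int t)))
       \<and> icoeff scaleV actV \<eta>V \<Psi>V b c \<theta> = icoeff scaleW actW \<eta>W \<Psi>W b \<theta> \<theta>
       \<and> (c \<le> b \<longrightarrow>
            icoeff scaleV actV \<eta>V \<Psi>V b c c =
              Omega_formula \<gamma> (int m) (int n - int (\<sigma> Two)) b c)
       \<and> (\<theta> \<le> b \<longrightarrow>
            icoeff scaleV actV \<eta>V \<Psi>V b c \<theta> =
              Omega_formula \<gamma> (int m - (int c - int \<theta>))
                (int n + (int c - int \<theta>) - int (\<sigma> Two)) b \<theta>)"
proof -
  have \<alpha>: "\<alpha> = 2 * \<gamma>" "\<gamma> > 0"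
    using assms(11-13) by auto
  have \<sigma>: "\<sigma> Two \<le> 1"
    using assms(1) by auto
  interpret V: icanonical_chain scaleV actV \<eta>V m n \<sigma> \<psi> \<Psi>V b c \<gamma>
  proof (intro icanonical_chain.intro icanonical_chain_axioms.intro)
    show "int m - int n + int b - 2 * int c + int (\<sigma> Two) = 2 * \<gamma>"
      using assms(10) \<alpha> by linarith
  qed (use assms(2-4,8,9) \<sigma> \<alpha>(2) in simp_all)
  interpret W: icanonical_chain scaleW actW \<eta>W "m - (c - \<theta>)" "n + (c - \<theta>)" \<sigma> \<psi> \<Psi>W b \<theta> \<gamma>
  proof (intro icanonical_chain.intro icanonical_chain_axioms.intro)
    have *: "int (m - (c - \<theta>)) = int m - (int c - int \<theta>)" "int (n + (c - \<theta>)) = int n + (int c - int \<theta>)"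
      using assms(5,8) by auto
    show "int (n + (c - \<theta>)) - int b + int \<theta> \<ge> 0"
      unfolding * using assms(9) by linarith
    show "int (m - (c - \<theta>)) - int (n + (c - \<theta>)) + int b - 2 * int \<theta> + int (\<sigma> Two) = 2 * \<gamma>"
      unfolding * using assms(10) \<alpha> by linarith
  qed (use assms(2,5-8) \<sigma> \<alpha>(2) in simp_all)
  have Omega: "Omega_formula \<gamma> (int m - (int c - int t)) (int n + (int c - int t) - int (\<sigma> Two)) b t =
      omega_coeff \<gamma> V.N t" for t
    using assms(10) \<alpha> by (intro Omega_formula_eq) auto
  have N: "W.N = V.N"
    using assms(5) by (simp add: of_nat_diff)
  have "icoeff scaleV actV \<eta>V \<Psi>V b c \<theta> = icoeff scaleW actW \<eta>W \<Psi>W b \<theta> \<theta>"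
    unfolding V.icoeff_eq[OF assms(5)] W.icoeff_eq[OF order.refl] N ..
  then show ?thesis
  proof (intro conjI impI)
    show "icoeff scaleV actV \<eta>V \<Psi>V b c c = Omega_formula \<gamma> (int m) (int n - int (\<sigma> Two)) b c"
      if "c \<le> b"
      using V.icoeff_eq[of c] Omega[of c] that by simp
    show "icoeff scaleV actV \<eta>V \<Psi>V b c \<theta> = Omega_formula \<gamma> (int m - (int c - int \<theta>))
        (int n + (int c - int \<theta>) - int (\<sigma> Two)) b \<theta>" if "\<theta> \<le> b"
      using V.icoeff_eq[OF assms(5)] Omega[of \<theta>] that by simp
  qed (use V.icanonical_expansion in simp_all)
qed

end
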